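(* Let $n\ge 3$ be an integer and let $k>0$ be a constant multiplicity function for the dihedral group $\mathcal{D}_2(n)$. Let $x=\rho e^{i\phi}$ and $y=re^{i\theta}$ with $\rho,r\ge0$ and $\phi,\theta\in[0,\pi/n]$. Then the generalized Bessel function $D_k^{\mathcal{D}_2(n)}$ satisfies $$D_k^{\mathcal{D}_2(n)}(x,y)=\frac{c_{n,k}}{nB(k+1/2,1/2)\,(\Gamma(k))^n}\int_{\Sigma_n}\exp\Bigl(\rho r\Bigl(u_0\cos(\theta-\phi)+\sum_{s=1}^{n-1}u_s b_s^{\theta-\phi,n}\Bigr)\Bigr)\ {}_0F_{n-1}\Bigl(2k,\underbrace{k,\dots,k}_{n-2};\,-4\bigl(\tfrac{\rho r}{2}\bigr)^n u_0u_1\cdots u_{n-1}\sin(n\theta)\sin(n\phi)\Bigr)\,u_0^{k-1}\prod_{s=1}^{n-1}u_s^{k-1}\,du_1\cdots du_{n-1},$$ where $b_s^{\theta-\phi,n}=\cos\bigl(\theta-\phi+\tfrac{2\pi s}{n}\bigr)$ for $s=1,\dots,n-1$.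
   Context: $\Sigma_n=\{(u_1,\dots,u_{n-1},u_0)\in\mathbb{R}^n:\ u_0:=1-u_1-\cdots-u_{n-1},\ u_0,u_1,\dots,u_{n-1}\ge0\}$ is the $(n-1)$-dimensional standard simplex, parametrized by $(u_1,\dots,u_{n-1})$ with Lebesgue measure $du_1\cdots du_{n-1}$. ${}_0F_{n-1}(a_1,\dots,a_{n-1};z)=\sum_{j\ge0}\frac{1}{(a_1)_j\cdots(a_{n-1})_j}\frac{z^j}{j!}$, where $(x)_j=x(x+1)\cdots(x+j-1)$, $(x)_0=1$, is the Pochhammer symbol. $B(u,v)=\Gamma(u)\Gamma(v)/\Gamma(u+v)$ is the Beta function. $C_j^{(k)}$ is the Gegenbauer polynomial, $\sum_{j\ge0}C_j^{(k)}(x)t^j=(1-2xt+t^2)^{-k}$, with $C_j^{(k)}(1)=(2k)_j/j!$. $I_\nu(v)=\sum_{m\ge0}\frac{1}{m!\,\Gamma(\nu+m+1)}(v/2)^{2m+\nu}$ is the modified Bessel function of the first kind. Generalized Bessel function: $\mathcal{D}_2(n)$ is the dihedral group of symmetries of the regular $n$-gon, with positive Weyl chamber $C=\{re^{i\theta}: r>0,\ 0<\theta<\pi/n\}$. For a constant multiplicity $k>0$ and $x=\rho e^{i\phi}$, $y=re^{i\theta}$ in $\overline{C}$ with $\rho r>0$, the associated generalized Bessel function is $$D_k^{\mathcal{D}_2(n)}(x,y)=\frac{c_{n,k}}{B(k+1/2,1/2)}\Bigl(\frac{2}{r\rho}\Bigr)^{nk}\sum_{j\ge0}I_{nj+nk}(\rho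 r)\,(j+k)\,\frac{C_j^{(k)}(\cos(n\phi))\,C_j^{(k)}(\cos(n\theta))}{C_j^{(k)}(1)},$$ extended by continuity to $\rho r=0$, where $c_{n,k}$ is the normalizing constant (depending only on $n,k$) determined by $D_k^{\mathcal{D}_2(n)}(0,y)=1$ for all $y\in\overline{C}$. *)

theory Defs
  imports
    "HOL-Analysis.Analysis"
    "HOL-Computational_Algebra.Formal_Power_Series"
begin

section \<open>Special functions\<close>

definition hypergeometric_0F :: "real list \<Rightarrow> real \<Rightarrow> real" where
  "hypergeometric_0F as z = (\<Sum>j. 1 / (\<Prod>a\<leftarrow>as. pochhammer a j) * (z ^ j / fact j))"

text \<open>The coefficient of \<open>t ^ j\<close> in \<open>(1 - 2 * x * t + t\<^sup>2)\<close> to the power \<open>-k\<close>: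
  \<open>fps_binomial a\<close> is the binomial series \<open>(1 + t)\<close> to the power \<open>a\<close>, into which
  \<open>t\<^sup>2 - 2 * x * t\<close> is substituted.\<close>
definition gegenbauer :: "real \<Rightarrow> nat \<Rightarrow> real \<Rightarrow> real" where
  "gegenbauer k j x =
     fps_nth (fps_compose (fps_binomial (- k)) (fps_X ^ 2 - fps_const (2 * x) * fps_X)) j"

text \<open>The factor \<open>v / 2\<close> is raised to a real power, so the argument is meant to be nonnegative.\<close>
definition bessel_I :: "real \<Rightarrow> real \<Rightarrow> real" where
  "bessel_I \<nu> v =
     (\<Sum>m. 1 / (fact m * Gamma (\<nu> + real m + 1)) * (v / 2) powr (2 * real m + \<nu>))"

section \<open>Generalized Bessel function of a dihedral group\<close>

definition weyl_chamber :: "nat \<Rightarrow> complex set" where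
  "weyl_chamber n = {rcis r \<theta> | r \<theta>. 0 < r \<and> 0 < \<theta> \<and> \<theta> < pi / real n}"

definition dihedral_bessel_series ::
    "real \<Rightarrow> nat \<Rightarrow> real \<Rightarrow> real \<Rightarrow> real \<Rightarrow> real \<Rightarrow> real \<Rightarrow> real" where
  "dihedral_bessel_series c n k \<rho> \<phi> r \<theta> =
     c / Beta (k + 1/2) (1/2) * (2 / (r * \<rho>)) powr (real n * k) *
     (\<Sum>j. bessel_I (real n * real j + real n * k) (\<rho> * r) * (real j + k) *
        (gegenbauer k j (cos (real n * \<phi>)) * gegenbauer k j (cos (real n * \<theta>))
          / gegenbauer k j 1))"

text \<open>The function with an arbitrary constant \<open>c\<close> in place of the normalizing one. It is meant
  for points of the closed chamber: \<open>Arg\<close> of a nonzero such point lies in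
  \<open>{0..pi / n}\<close>. Where one of the points is \<open>0\<close>, the value is the
  joint limit along pairs of nonzero points of the closed chamber.\<close>
definition dihedral_bessel_with :: "real \<Rightarrow> nat \<Rightarrow> real \<Rightarrow> complex \<Rightarrow> complex \<Rightarrow> real" where
  "dihedral_bessel_with c n k x y =
     (let D = (\<lambda>(x, y). dihedral_bessel_series c n k (cmod x) (Arg x) (cmod y) (Arg y));
          S = closure (weyl_chamber n) - {0}
      in if x \<noteq> 0 \<and> y \<noteq> 0 then D (x, y) else Lim (at (x, y) within S \<times> S) D)"

definition dihedral_bessel_const :: "nat \<Rightarrow> real \<Rightarrow> real" where
  "dihedral_bessel_const n k =
     (THE c. \<forall>y \<in> closure (weyl_chamber n). dihedral_bessel_with c n k 0 y = 1)"

definition dihedral_bessel :: "nat \<Rightarrow> real \<Rightarrow> complex \<Rightarrow> complex \<Rightarrow> real" where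
  "dihedral_bessel n k = dihedral_bessel_with (dihedral_bessel_const n k) n k"

section \<open>The standard simplex in the coordinates $u_1, \dots, u_{n-1}$\<close>

text \<open>A point of \<open>\<real>\<close> to the power \<open>n - 1\<close> is an extensional function on \<open>{1..<n}\<close>,
  as in the product measure \<open>\<Pi>\<^sub>M s\<in>{1..<n}. lborel\<close>.\<close>

definition simplex_u0 :: "nat \<Rightarrow> (nat \<Rightarrow> real) \<Rightarrow> real" where
  "simplex_u0 n u = 1 - (\<Sum>s=1..<n. u s)"

definition standard_simplex :: "nat \<Rightarrow> (nat \<Rightarrow> real) set" where
  "standard_simplex n =
     {u \<in> {1..<n} \<rightarrow>\<^sub>E UNIV. simplex_u0 n u \<ge> 0 \<and> (\<forall>s\<in>{1..<n}. u s \<ge> 0)}"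

end

theory Submission
  imports Defs "HOL-Computational_Algebra.Formal_Laurent_Series"
begin

text \<open>
  Both sides are power series in \<open>z = \<rho> * r\<close>, and the identity reduces to an identity between
  coefficients. Dirichlet integrals turn the coefficients of the integral into those of
  \<open>\<Prod>s. 1 - 2 * b\<^sub>s * x\<close> raised to the powers \<open>-(k + m)\<close> (morally, one takes a Laplace transform
  in \<open>z\<close>). With \<open>x = w / (1 + w\<^sup>2)\<close> this product becomes, up to a power of \<open>1 + w\<^sup>2\<close>, the
  trinomial \<open>1 - 2 * cos (n * (\<theta> - \<phi>)) * w\<^sup>n + w\<^sup>2\<^sup>n\<close>, so that generating functions of Gegenbauer
  polynomials with parameters \<open>k + m\<close> appear. Their combination is the series of the
  products of two Gegenbauer polynomials: as functions of one angle, the two sides of this product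
  formula solve the same singular differential equation with the same value at \<open>0\<close>, and an energy estimate
  gives uniqueness. Expanding powers of \<open>1 + w\<^sup>2\<close> back in \<open>x\<close> yields the coefficients of the Bessel
  functions. The normalizing constant enters linearly, so its value plays no role.
\<close>

text \<open>The Laplace transform is only a guide: the factor \<open>Gamma (n * k + N)\<close> that
  it attaches to degree \<open>N\<close> in \<open>z\<close> is the same on both sides, so it is
  split off degree by degree and no transform has to converge. It turns the series of
  \<open>I\<close> with index \<open>\<nu> = n * (k + j)\<close> into that of \<open>1 + w^2\<close>
  to the power \<open>\<nu>\<close>, divided by \<open>\<nu>\<close>; as the Bessel series carries
  \<open>j + k\<close>, this leaves the \<open>n\<close> in the denominator of the claim. On the
  other side the \<open>m\<close>-th hypergeometric term raises every Dirichlet parameter to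
  \<open>k + m\<close>, and \<open>Gamma (k + m) ^ n\<close> yields
  \<open>pochhammer k m ^ n\<close>. Dividing by the Pochhammer symbols of the parameters
  \<open>2k, k, ..., k\<close> leaves the square of \<open>pochhammer k m\<close> over
  \<open>pochhammer (2 * k) m\<close>, exactly what a Taylor expansion in the Gegenbauer product
  formula produces. Comparing coefficients needs no infinite sum of formal series: the substitution
  \<open>x = w / (1 + w^2)\<close> preserves the order of vanishing, so sums truncated at
  \<open>N\<close> suffice for the coefficient of index \<open>N\<close>.\<close>

unbundle fps_syntax
unbundle no vec_syntax

section \<open>Real powers of formal power series\<close>

text \<open>Meant for \<open>g\<close> with constant term \<open>1\<close>; otherwise the substitution is not a legitimate one.\<close>
definition fps_rpow :: "real fps \<Rightarrow> real \<Rightarrow> real fps" where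
  "fps_rpow g a = fps_binomial a oo (g - 1)"

lemma fps_rpow_nth_0 [simp]: "fps_rpow g a $ 0 = 1"
  by (simp add: fps_rpow_def)

lemma fps_rpow_add:
  assumes "g $ 0 = 1"
  shows "fps_rpow g (a + b) = fps_rpow g a * fps_rpow g b"
  using assms by (simp add: fps_rpow_def fps_binomial_add_mult fps_compose_mult_distrib)

lemma fps_rpow_of_nat:
  assumes "g $ 0 = 1"
  shows "fps_rpow g (real m) = g ^ m"
proof -
  have "(1 + fps_X :: real fps) oo (g - 1) = g"
    using assms by (simp add: fps_compose_add_distrib)
  then show ?thesis
    using assms by (simp add: fps_rpow_def fps_binomial_of_nat flip: fps_compose_power)
qed

lemma fps_rpow_0 [simp]: "fps_rpow g 0 = 1"
  by (simp add: fps_rpow_def)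

lemma fps_rpow_compose:
  assumes "g $ 0 = 1" "h $ 0 = 0"
  shows "fps_rpow g a oo h = fps_rpow (g oo h) a"
  using assms by (simp add: fps_rpow_def fps_compose_sub_distrib flip: fps_compose_assoc)

lemma fps_rpow_deriv:
  assumes "g $ 0 = 1"
  shows "g * fps_deriv (fps_rpow g a) = fps_const a * fps_deriv g * fps_rpow g a"
proof -
  have "(1 + fps_X) * fps_deriv (fps_binomial a) = fps_const a * fps_binomial a"
    by (simp add: fps_binomial_deriv fps_divide_unit mult.commute mult.left_commute inverse_mult_eq_1')
  then have "((1 + fps_X) * fps_deriv (fps_binomial a)) oo (g - 1) =
      (fps_const a * fps_binomial a) oo (g - 1)"
    by simp
  moreover have "(1 + fps_X :: real fps) oo (g - 1) = g"
    using assms by (simp add: fps_compose_add_distrib)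
  ultimately have "g * (fps_deriv (fps_binomial a) oo (g - 1)) = fps_const a * fps_rpow g a"
    using assms by (simp add: fps_compose_mult_distrib fps_rpow_def)
  then show ?thesis
    using assms by (simp add: fps_rpow_def fps_compose_deriv algebra_simps)
qed

text \<open>The product of \<open>P\<close> with the power \<open>-a\<close> of \<open>g\<close> has
  derivative zero once \<open>g\<close> is cancelled, so it equals its constant term
  \<open>1\<close>. This is the route to multiplicativity in the base, which substitution into the
  binomial series does not show directly.\<close>

lemma fps_rpow_ODE_unique:
  assumes g: "g $ 0 = 1" and P0: "P $ 0 = 1"
    and P: "g * fps_deriv P = fps_const a * fps_deriv g * P"
  shows "P = fps_rpow g a"
proof -
  define Q where "Q = fps_rpow g (- a)"
  have Q: "g * fps_deriv Q = - (fps_const a * fps_deriv g * Q)"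
    using fps_rpow_deriv[OF g, of "- a"] by (simp add: Q_def flip: fps_const_neg)
  have "g * fps_deriv (P * Q) = (g * fps_deriv P) * Q + P * (g * fps_deriv Q)"
    by (simp add: algebra_simps)
  also have "\<dots> = 0"
    unfolding P Q by (simp add: algebra_simps)
  finally have "fps_deriv (P * Q) = 0"
    using g by (metis mult_eq_0_iff fps_zero_nth zero_neq_one)
  then have "P * Q = fps_const ((P * Q) $ 0)"
    by (simp only: fps_deriv_eq_0_iff)
  then have "P * Q = 1"
    by (simp add: P0 Q_def)
  moreover have "fps_rpow g a * Q = 1"
    using fps_rpow_add[OF g, of a "- a"] by (simp add: Q_def)
  ultimately show ?thesis
    by (metis mult.assoc mult.commute mult_1)
qed

lemma fps_rpow_mult:
  assumes "g $ 0 = 1" "h $ 0 = 1"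
  shows "fps_rpow (g * h) a = fps_rpow g a * fps_rpow h a"
proof (rule fps_rpow_ODE_unique[symmetric])
  have "g * h * fps_deriv (fps_rpow g a * fps_rpow h a) =
      (g * fps_deriv (fps_rpow g a)) * (h * fps_rpow h a)
      + (h * fps_deriv (fps_rpow h a)) * (g * fps_rpow g a)"
    by (simp add: algebra_simps)
  also have "\<dots> = fps_const a * fps_deriv (g * h) * (fps_rpow g a * fps_rpow h a)"
    unfolding fps_rpow_deriv[OF assms(1)] fps_rpow_deriv[OF assms(2)]
    by (simp add: algebra_simps)
  finally show "g * h * fps_deriv (fps_rpow g a * fps_rpow h a) =
    fps_const a * fps_deriv (g * h) * (fps_rpow g a * fps_rpow h a)" .
qed (use assms in auto)

lemma fps_nth_prod_0: "(\<Prod>s\<in>A. g s) $ 0 = (\<Prod>s\<in>A. g s $ 0)" for g :: "'a \<Rightarrow> real fps"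
  by (induction A rule: infinite_finite_induct) auto

lemma fps_rpow_prod:
  assumes "finite A" "\<And>s. s \<in> A \<Longrightarrow> g s $ 0 = 1"
  shows "fps_rpow (\<Prod>s\<in>A. g s) a = (\<Prod>s\<in>A. fps_rpow (g s) a)"
  using assms
proof (induction A rule: finite_induct)
  case empty
  then show ?case by (simp add: fps_rpow_def)
next
  case (insert s A)
  then show ?case
    by (simp add: fps_rpow_mult fps_nth_prod_0)
qed

lemma fps_rpow_power:
  assumes "g $ 0 = 1"
  shows "fps_rpow (g ^ m) a = fps_rpow g (real m * a)"
proof (induction m)
  case 0
  then show ?case by (simp add: fps_rpow_def)
next
  case (Suc m)
  then show ?case
    using assms by (simp add: fps_rpow_mult fps_rpow_add distrib_right fps_power_zeroth)
qed

lemma gchoose_neg: "(- a) gchoose m = (- 1) ^ m * pochhammer a m / fact m" for a :: real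
  by (simp add: gbinomial_pochhammer)

lemma fps_rpow_linear_nth:
  "fps_rpow (1 - fps_const b * fps_X) (- a) $ m = pochhammer a m / fact m * b ^ m"
proof -
  have eq: "1 - fps_const b * fps_X - 1 = fps_const (- b) * (fps_X :: real fps)"
    by (simp flip: fps_const_neg)
  show ?thesis
    unfolding fps_rpow_def eq fps_compose_linear
    by (simp add: gchoose_neg power_minus[of b])
qed

section \<open>Gegenbauer polynomials\<close>

definition gegenbauer_gf :: "real \<Rightarrow> real \<Rightarrow> real fps" where
  "gegenbauer_gf k x = fps_rpow (1 - fps_const (2 * x) * fps_X + fps_X\<^sup>2) (- k)"

lemma gegenbauer_gf_nth: "gegenbauer_gf k x $ j = gegenbauer k j x"
  by (simp add: gegenbauer_gf_def gegenbauer_def fps_rpow_def)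

lemma gegenbauer_0 [simp]: "gegenbauer k 0 x = 1"
  by (simp add: gegenbauer_gf_def flip: gegenbauer_gf_nth)

lemma gegenbauer_gf_Suc:
  "gegenbauer_gf k x = (1 - fps_const (2 * x) * fps_X + fps_X\<^sup>2) * gegenbauer_gf (k + 1) x"
proof -
  let ?f = "1 - fps_const (2 * x) * fps_X + fps_X\<^sup>2 :: real fps"
  have f: "?f $ 0 = 1" by (simp add: power2_eq_square)
  show ?thesis
    using fps_rpow_add[OF f, of 1 "- (k + 1)"] fps_rpow_of_nat[OF f, of 1]
    by (simp add: gegenbauer_gf_def)
qed

lemma gegenbauer_gf_deriv:
  "fps_deriv (gegenbauer_gf k x) = fps_const (2 * k) * (fps_const x - fps_X) * gegenbauer_gf (k + 1) x"
proof -
  let ?f = "1 - fps_const (2 * x) * fps_X + fps_X\<^sup>2 :: real fps"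
  have f: "?f $ 0 = 1" by (simp add: power2_eq_square)
  have d: "fps_const (- k) * fps_deriv ?f = fps_const (2 * k) * (fps_const x - fps_X)"
    by (rule fps_ext) (simp add: power2_eq_square fps_numeral_nth)
  have "?f * fps_deriv (gegenbauer_gf k x) =
      fps_const (- k) * fps_deriv ?f * gegenbauer_gf k x"
    unfolding gegenbauer_gf_def by (rule fps_rpow_deriv[OF f])
  also have "\<dots> = ?f * (fps_const (2 * k) * (fps_const x - fps_X) * gegenbauer_gf (k + 1) x)"
    unfolding d by (subst gegenbauer_gf_Suc) (simp only: ac_simps)
  finally show ?thesis
    using f by (metis mult_cancel_left fps_zero_nth zero_neq_one)
qed

lemma gegenbauer_gf_deriv':
  "(1 - fps_const (2 * x) * fps_X + fps_X\<^sup>2) * fps_deriv (gegenbauer_gf k x) =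
    fps_const (2 * k) * (fps_const x - fps_X) * gegenbauer_gf k x"
  unfolding gegenbauer_gf_deriv by (subst (2) gegenbauer_gf_Suc) (simp only: ac_simps)

lemma gegenbauer_1 [simp]: "gegenbauer k (Suc 0) x = 2 * k * x"
  using arg_cong[OF gegenbauer_gf_deriv'[of x k], of "\<lambda>F. F $ 0"]
  by (simp add: gegenbauer_gf_nth)

lemma gegenbauer_rec:
  "(real j + 2) * gegenbauer k (Suc (Suc j)) x =
    2 * x * (real j + 1 + k) * gegenbauer k (Suc j) x - (real j + 2 * k) * gegenbauer k j x"
proof -
  have "((1 - fps_const (2 * x) * fps_X + fps_X\<^sup>2) * fps_deriv (gegenbauer_gf k x)) $ Suc j
      = (fps_const (2 * k) * (fps_const x - fps_X) * gegenbauer_gf k x) $ Suc j"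
    by (simp only: gegenbauer_gf_deriv')
  then show ?thesis
    by (simp add: distrib_right left_diff_distrib fps_X_power_mult_nth mult.assoc gegenbauer_gf_nth
        right_diff_distrib)
      (cases j; simp add: algebra_simps gegenbauer_gf_nth)
qed

text \<open>With \<open>f = 1 - 2xX + X^2\<close>, applying \<open>X d/dX + k\<close> to
  \<open>f^(-k)\<close> gives \<open>k (1 - X^2) f^(-k-1)\<close>: the terms linear in
  \<open>X\<close> cancel.\<close>

lemma gegenbauer_rec_parameter:
  "(real j + 2 + k) * gegenbauer k (Suc (Suc j)) x =
    k * (gegenbauer (k + 1) (Suc (Suc j)) x - gegenbauer (k + 1) j x)"
proof -
  define f :: "real fps" where "f = 1 - fps_const (2 * x) * fps_X + fps_X\<^sup>2"
  define B where "B = gegenbauer_gf (k + 1) x"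
  have "fps_X * fps_deriv (gegenbauer_gf k x) + fps_const k * gegenbauer_gf k x =
      fps_X * (fps_const (2 * k) * (fps_const x - fps_X) * B) + fps_const k * (f * B)"
    unfolding gegenbauer_gf_deriv by (simp only: f_def B_def gegenbauer_gf_Suc[of k])
  also have "\<dots> = fps_const k * ((1 - fps_X\<^sup>2) * B)"
  proof -
    have "fps_const (2 * k) = 2 * fps_const k" "fps_const (2 * x) = 2 * fps_const x"
      by (simp_all add: fps_numeral_fps_const)
    then show ?thesis
      unfolding f_def by (simp only:) (simp add: algebra_simps power2_eq_square del: fps_const_mult)
  qed
  finally have "(fps_X * fps_deriv (gegenbauer_gf k x) + fps_const k * gegenbauer_gf k x) $ Suc (Suc j)
    = (fps_const k * ((1 - fps_X\<^sup>2) * B)) $ Suc (Suc j)" by simp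
  then show ?thesis
    by (simp add: B_def left_diff_distrib fps_X_power_mult_nth gegenbauer_gf_nth)
      (simp add: algebra_simps)
qed

text \<open>Here \<open>x\<close> varies while the generating function is formal in another
  variable, so the proof is an induction over the three-term recurrence. Differentiating the
  recurrence leaves one term with parameter \<open>k\<close>, which
  \<open>gegenbauer_rec_parameter\<close> moves to parameter \<open>k + 1\<close>.\<close>

lemma gegenbauer_has_real_derivative:
  "(gegenbauer k (Suc j) has_real_derivative 2 * k * gegenbauer (k + 1) j x) (at x)"
proof (induction j rule: induct_nat_012)
  case 0
  have "gegenbauer k (Suc 0) = (\<lambda>x. 2 * k * x)" by auto
  then show ?case by (auto intro!: derivative_eq_intros)
next
  case 1
  have eq: "gegenbauer k (Suc (Suc 0)) = (\<lambda>x. (2 * x * (1 + k) * (2 * k * x) - 2 * k) / 2)"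
    using gegenbauer_rec[of 0 k] by (auto simp: fun_eq_iff mult.commute)
  show ?case unfolding eq by (auto intro!: derivative_eq_intros simp: algebra_simps)
next
  case (ge2 j)
  let ?D = "(2 * (real j + 2 + k) * gegenbauer k (Suc (Suc j)) x
      + 2 * x * (real j + 2 + k) * (2 * k * gegenbauer (k + 1) (Suc j) x)
      - (real j + 1 + 2 * k) * (2 * k * gegenbauer (k + 1) j x)) / (real j + 3)"
  have eq: "gegenbauer k (Suc (Suc (Suc j))) =
      (\<lambda>x. (2 * x * (real j + 2 + k) * gegenbauer k (Suc (Suc j)) x
        - (real j + 1 + 2 * k) * gegenbauer k (Suc j) x) / (real j + 3))"
    using gegenbauer_rec[of "Suc j" k] by (auto simp: fun_eq_iff field_simps)
  have "(gegenbauer k (Suc (Suc (Suc j))) has_real_derivative ?D) (at x)"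
    unfolding eq
    by (rule DERIV_cdivide) (rule derivative_eq_intros ge2 refl | simp)+
  moreover have "?D = 2 * k * gegenbauer (k + 1) (Suc (Suc j)) x"
    using gegenbauer_rec_parameter[of j k x] gegenbauer_rec[of j "k + 1" x]
    by (simp add: field_simps) algebra
  ultimately show ?case by simp
qed

lemma gegenbauer_uminus: "gegenbauer k j (- x) = (- 1) ^ j * gegenbauer k j x"
proof (induction j rule: induct_nat_012)
  case (ge2 j)
  have "(real j + 2) * gegenbauer k (Suc (Suc j)) (- x) =
      (real j + 2) * ((- 1) ^ Suc (Suc j) * gegenbauer k (Suc (Suc j)) x)"
    unfolding mult.left_commute[of "real j + 2" "(- 1) ^ Suc (Suc j)"] gegenbauer_rec ge2
    by (simp add: algebra_simps)
  then show ?case by (metis mult_cancel_left of_nat_0_le_iff add_nonneg_eq_0_iff zero_le_numeral zero_neq_numeral)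
qed auto

lemma gegenbauer_at_1: "gegenbauer k j 1 = pochhammer (2 * k) j / fact j"
proof (induction j rule: induct_nat_012)
  case (ge2 j)
  have "(real j + 2) * gegenbauer k (Suc (Suc j)) 1 =
      (real j + 2) * (pochhammer (2 * k) (Suc (Suc j)) / fact (Suc (Suc j)))"
    unfolding gegenbauer_rec ge2 by (simp add: pochhammer_Suc divide_simps) (simp add: algebra_simps)
  then show ?case by (metis mult_cancel_left of_nat_0_le_iff add_nonneg_eq_0_iff zero_le_numeral zero_neq_numeral)
qed (auto simp: pochhammer_Suc)

text \<open>The shift by \<open>fps_X ^ m\<close> gives, up to constants, the \<open>m\<close>-th derivative of
  \<open>gegenbauer k j\<close>, and \<open>0\<close> when \<open>m > j\<close>.\<close>
definition gegenbauer_shift :: "real \<Rightarrow> nat \<Rightarrow> nat \<Rightarrow> real \<Rightarrow> real" where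
  "gegenbauer_shift k j m x = (fps_X ^ m * gegenbauer_gf (k + real m) x) $ j"

lemma gegenbauer_shift_eq:
  "gegenbauer_shift k j m x = (if j < m then 0 else gegenbauer (k + real m) (j - m) x)"
  by (simp add: gegenbauer_shift_def fps_X_power_mult_nth gegenbauer_gf_nth)

lemma gegenbauer_shift_has_real_derivative:
  "(gegenbauer_shift k j m has_real_derivative
     2 * (k + real m) * gegenbauer_shift k j (Suc m) x) (at x)"
proof (cases "Suc m \<le> j")
  case True
  then obtain i where i: "j = Suc (m + i)" by (metis Suc_leD add_Suc less_eqE)
  have "gegenbauer_shift k j m = gegenbauer (k + real m) (Suc i)"
    using i by (auto simp: fun_eq_iff gegenbauer_shift_eq Suc_diff_le)
  then show ?thesis
    using gegenbauer_has_real_derivative[of "k + real m" i x]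
    by (simp add: i gegenbauer_shift_eq add.assoc add.commute[of 1])
next
  case False
  then have "gegenbauer_shift k j m = (\<lambda>_. if j < m then 0 else 1)"
    by (auto simp: fun_eq_iff gegenbauer_shift_eq)
  with False show ?thesis by (simp add: gegenbauer_shift_eq)
qed

text \<open>All four summands are polynomial multiples of \<open>gegenbauer_gf (k + 2) x\<close>, so
  the equation reduces to an identity between polynomials. The operator \<open>X d/dX\<close>
  multiplies the coefficient of index \<open>j\<close> by \<open>j\<close>, and the shifted series
  are derivatives in \<open>x\<close> up to constants.\<close>

lemma gegenbauer_gf_ODE:
  "fps_const (4 * k * (k + 1) * (1 - x\<^sup>2)) * (fps_X\<^sup>2 * gegenbauer_gf (k + 2) x)
    - fps_const (2 * k * (2 * k + 1) * x) * (fps_X * gegenbauer_gf (k + 1) x)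
    + fps_X * fps_deriv (fps_X * fps_deriv (gegenbauer_gf k x))
    + fps_const (2 * k) * (fps_X * fps_deriv (gegenbauer_gf k x)) = 0"
proof -
  define f :: "real fps" where "f = 1 - fps_const (2 * x) * fps_X + fps_X\<^sup>2"
  define B where "B = gegenbauer_gf (k + 2) x"
  define K Y where KY: "K = fps_const k" "Y = fps_const x"
  have f: "f = 1 - 2 * Y * fps_X + fps_X\<^sup>2"
    by (simp add: f_def KY fps_numeral_fps_const)
  have B1: "gegenbauer_gf (k + 1) x = f * B"
    using gegenbauer_gf_Suc[of "k + 1" x] by (simp add: f_def B_def add.assoc)
  have D0: "fps_deriv (gegenbauer_gf k x) = 2 * K * (Y - fps_X) * (f * B)"
    unfolding gegenbauer_gf_deriv B1 by (simp add: KY fps_numeral_fps_const)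
  have D1: "fps_deriv (f * B) = 2 * (K + 1) * (Y - fps_X) * B"
    unfolding B1[symmetric] gegenbauer_gf_deriv
    by (simp add: KY B_def fps_numeral_fps_const add.assoc del: fps_const_add flip: fps_const_add)
  have c: "fps_const (4 * k * (k + 1) * (1 - x\<^sup>2)) = 4 * K * (K + 1) * (1 - Y\<^sup>2)"
    "fps_const (2 * k * (2 * k + 1) * x) = 2 * K * (2 * K + 1) * Y"
    "fps_const (2 * k) = 2 * K"
    by (simp_all add: KY fps_numeral_fps_const fps_const_power flip: fps_const_1_eq_1)
  have D2: "fps_deriv (fps_X * (2 * K * (Y - fps_X) * (f * B))) =
     2 * K * (Y - 2 * fps_X) * (f * B) + 2 * K * fps_X * (Y - fps_X) * (2 * (K + 1) * (Y - fps_X) * B)"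
  proof -
    have d: "fps_deriv (2 :: real fps) = 0" "fps_deriv K = 0" "fps_deriv Y = 0"
      by (simp_all add: KY fps_numeral_fps_const)
    have "fps_deriv (fps_X * (2 * K * (Y - fps_X))) = 2 * K * (Y - 2 * fps_X)"
      unfolding fps_deriv_mult fps_deriv_sub d by (simp add: algebra_simps)
    moreover have "fps_deriv (fps_X * (2 * K * (Y - fps_X)) * (f * B)) =
      fps_deriv (fps_X * (2 * K * (Y - fps_X))) * (f * B) + fps_X * (2 * K * (Y - fps_X)) * fps_deriv (f * B)"
      by (subst fps_deriv_mult) (simp only: ac_simps)
    ultimately show ?thesis unfolding D1 by (simp only: ac_simps)
  qed
  show ?thesis
    unfolding B1 D0 c B_def[symmetric]
    unfolding D2
    unfolding f by (simp add: algebra_simps power2_eq_square)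
qed

text \<open>Gegenbauer's equation \<open>(1 - x^2) y'' - (2k + 1) x y' + j (j + 2k) y = 0\<close>,
  with both derivatives of \<open>y\<close> expressed by shifts.\<close>

lemma gegenbauer_ODE:
  "(1 - x\<^sup>2) * (4 * k * (k + 1)) * gegenbauer_shift k j 2 x
    - 2 * k * (2 * k + 1) * x * gegenbauer_shift k j 1 x
    + real j * (real j + 2 * k) * gegenbauer_shift k j 0 x = 0"
proof -
  have "(fps_X * fps_deriv F) $ j = real j * F $ j" for F :: "real fps"
    by (cases j) auto
  note D = this
  have "4 * k * (k + 1) * (1 - x\<^sup>2) * (fps_X\<^sup>2 * gegenbauer_gf (k + 2) x) $ j
    - 2 * k * (2 * k + 1) * x * (fps_X * gegenbauer_gf (k + 1) x) $ j
    + real j * (real j * gegenbauer_gf k x $ j) + 2 * k * (real j * gegenbauer_gf k x $ j) = 0"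
    using arg_cong[OF gegenbauer_gf_ODE[of k x], of "\<lambda>F. F $ j"]
    by (simp only: fps_add_nth fps_sub_nth fps_mult_left_const_nth D fps_zero_nth)
  then show ?thesis
    by (simp add: gegenbauer_shift_def algebra_simps del: fps_X_mult_nth)
qed

lemma gegenbauer_shift_shift:
  assumes "m \<le> j"
  shows "gegenbauer_shift k j (m + l) = gegenbauer_shift (k + real m) (j - m) l"
  using assms by (auto simp: fun_eq_iff gegenbauer_shift_eq add.assoc)

lemma gegenbauer_shift_ODE:
  "(1 - x\<^sup>2) * (4 * (k + real m) * (k + real m + 1)) * gegenbauer_shift k j (m + 2) x
    - 2 * (k + real m) * (2 * (k + real m) + 1) * x * gegenbauer_shift k j (m + 1) x
    + (real j - real m) * (real j + real m + 2 * k) * gegenbauer_shift k j m x = 0"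
proof (cases "m \<le> j")
  case True
  have "gegenbauer_shift k j m = gegenbauer_shift (k + real m) (j - m) 0"
    using gegenbauer_shift_shift[OF True, of k 0] by simp
  then show ?thesis
    using gegenbauer_ODE[of x "k + real m" "j - m"] True
    unfolding gegenbauer_shift_shift[OF True] by (simp add: of_nat_diff algebra_simps)
qed (simp add: gegenbauer_shift_eq)

section \<open>The product formula\<close>

text \<open>The energy \<open>E = l h^2 + h'^2\<close> has derivative
  \<open>2 h' (h'' + l h)\<close>, which by the equation equals \<open>-4k cot(a) h'^2\<close> for
  \<open>a > 0\<close>; it is nonpositive while the cosine is nonnegative, hence the interval up to
  \<open>pi / 2\<close>. At the singular point \<open>a = 0\<close> the equation itself forces
  \<open>h' 0 = 0\<close>, so only the value of \<open>h\<close> at \<open>0\<close> enters the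
  bound.\<close>

lemma energy_bound:
  fixes h h' h'' :: "real \<Rightarrow> real"
  assumes k: "k > 0"
    and D1: "\<And>a. (h has_real_derivative h' a) (at a)"
    and D2: "\<And>a. (h' has_real_derivative h'' a) (at a)"
    and ODE: "\<And>a. sin a * h'' a + 2 * k * cos a * h' a + l * sin a * h a = 0"
    and a: "a \<in> {0..pi / 2}"
  shows "l * (h a)\<^sup>2 + (h' a)\<^sup>2 \<le> l * (h 0)\<^sup>2"
proof -
  define E where "E = (\<lambda>a. l * (h a)\<^sup>2 + (h' a)\<^sup>2)"
  have h'0: "h' 0 = 0"
    using ODE[of 0] k by simp
  have E: "(E has_real_derivative 2 * h' a * (h'' a + l * h a)) (at a)" for a
    unfolding E_def by (rule derivative_eq_intros D1 D2 refl)+ (simp add: algebra_simps)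
  have "E a \<le> E 0"
  proof (rule DERIV_nonpos_imp_nonincreasing[of 0 a E])
    fix x assume x: "0 \<le> x" "x \<le> a"
    have "2 * h' x * (h'' x + l * h x) \<le> 0"
    proof (cases "x = 0")
      case False
      then have s: "sin x > 0"
        using x a by (intro sin_gt_zero) auto
      have c: "cos x \<ge> 0"
        using x a by (intro cos_ge_zero) auto
      have "sin x * (2 * h' x * (h'' x + l * h x)) = - (4 * k * cos x * (h' x)\<^sup>2)"
        using ODE[of x] by (simp add: power2_eq_square) algebra
      also have "\<dots> \<le> 0"
        using k c by simp
      finally show ?thesis
        using s by (simp add: mult_le_0_iff)
    qed (simp add: h'0)
    with E show "\<exists>y. (E has_real_derivative y) (at x) \<and> y \<le> 0" by blast
  qed (use a in auto)
  then show ?thesis by (simp add: E_def h'0)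
qed

lemma gegenbauer_shift_deriv_chain:
  assumes "(f has_real_derivative f') (at x)"
  shows "((\<lambda>x. gegenbauer_shift k j m (f x)) has_real_derivative
    2 * (k + real m) * gegenbauer_shift k j (Suc m) (f x) * f') (at x)"
  by (rule DERIV_chain2[OF gegenbauer_shift_has_real_derivative assms])

text \<open>For the normalized weight \<open>(1 - t^2)^(k-1)\<close> the mean of
  \<open>(t - 1)^m\<close> is \<open>(-2)^m * pochhammer k m / pochhammer (2 * k) m\<close>. The
  remaining factor \<open>2^m * pochhammer k m / fact m\<close> comes from the \<open>m\<close>-th
  Taylor coefficient of a Gegenbauer polynomial.\<close>

definition gegenbauer_product_coeff :: "real \<Rightarrow> nat \<Rightarrow> real" where
  "gegenbauer_product_coeff k m = (- 4) ^ m * (pochhammer k m)\<^sup>2 / (pochhammer (2 * k) m * fact m)"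

text \<open>Averaging \<open>gegenbauer k j (cos a * cos b + sin a * sin b * t)\<close> over \<open>t \<in> {-1..1}\<close> with weight
  proportional to \<open>(1 - t\<^sup>2)\<close> to the power \<open>k - 1\<close>, after Taylor expansion at \<open>t = 1\<close>.\<close>
definition gegenbauer_product :: "real \<Rightarrow> nat \<Rightarrow> real \<Rightarrow> real \<Rightarrow> real" where
  "gegenbauer_product k j b a = (\<Sum>m\<le>j. gegenbauer_product_coeff k m *
     ((sin a * sin b) ^ m * gegenbauer_shift k j m (cos (a - b))))"

lemma gegenbauer_product_coeff_Suc:
  assumes "k > 0"
  shows "gegenbauer_product_coeff k (Suc m) * (real (Suc m) * (2 * k + real m)) =
    - 4 * (k + real m)\<^sup>2 * gegenbauer_product_coeff k m"
proof -
  have "pochhammer (2 * k) m > 0" "2 * k + real m > 0"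
    using assms by (auto intro!: pochhammer_pos add_pos_nonneg)
  then show ?thesis
    by (simp add: gegenbauer_product_coeff_def pochhammer_Suc divide_simps power2_eq_square)
qed

text \<open>The left-hand side is \<open>sin a * h'' + 2k cos a * h' + j (j + 2k) sin a * h\<close>
  for \<open>h = q^m * P m\<close> as a function of \<open>a\<close>. The equation for
  \<open>P\<close> removes \<open>P (m + 2)\<close>, and the two terms that remain have the shape
  that telescopes in the sum over \<open>m\<close>.\<close>

lemma gegenbauer_product_term_ODE:
  fixes a b k :: real and j m :: nat
  defines "P \<equiv> \<lambda>m. gegenbauer_shift k j m (cos (a - b))"
    and "q \<equiv> sin a * sin b" and "M \<equiv> real m"
  shows "sin a * (M * (M - 1) * q ^ (m - 2) * (cos a * sin b)\<^sup>2 * P m - M * q ^ m * P m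
      - 4 * M * (k + M) * q ^ (m - 1) * cos a * sin b * sin (a - b) * P (m + 1)
      - 2 * (k + M) * q ^ m * cos (a - b) * P (m + 1)
      + 4 * (k + M) * (k + M + 1) * q ^ m * (sin (a - b))\<^sup>2 * P (m + 2))
    + 2 * k * cos a * (M * q ^ (m - 1) * cos a * sin b * P m
      - 2 * (k + M) * q ^ m * sin (a - b) * P (m + 1))
    + real j * (real j + 2 * k) * sin a * (q ^ m * P m)
    = sin b * (M * (M - 1 + 2 * k) * q ^ (m - 1) * P m + 4 * (k + M)\<^sup>2 * q ^ m * P (m + 1))"
proof -
  define c s where cs: "c = cos (a - b)" "s = sin (a - b)"
  have trig: "(sin a)\<^sup>2 + (cos a)\<^sup>2 = 1" "(sin b)\<^sup>2 + (cos b)\<^sup>2 = 1" "s\<^sup>2 = 1 - c\<^sup>2"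
    by (simp_all add: cs sin_squared_eq)
  have c: "c = cos a * cos b + sin a * sin b" and s: "s = sin a * cos b - cos a * sin b"
    by (simp_all add: cs cos_diff sin_diff)
  \<comment> \<open>These identities eliminate \<open>cos a\<close> and \<open>s\<close>, so that
    only \<open>sin a\<close>, \<open>sin b\<close>, \<open>c\<close> and \<open>q\<close>
    remain.\<close>
  have e1: "sin a * (cos a * sin b)\<^sup>2 = q * (sin b - sin a * q)"
    using trig(1) unfolding q_def by algebra
  have e2: "sin a * (cos a * sin b * s) = q * (sin a * c - sin b)"
    using trig(1) unfolding q_def c s by algebra
  have e3: "cos a * s = sin a * c - sin b"
    using trig(1) unfolding c s by algebra
  have e4: "cos a * (cos a * sin b) = sin b - sin a * q"
    using trig(1) unfolding q_def by algebra
  have O: "(1 - c\<^sup>2) * (4 * (k + M) * (k + M + 1)) * P (m + 2)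
    - 2 * (k + M) * (2 * (k + M) + 1) * c * P (m + 1)
    + (real j - M) * (real j + M + 2 * k) * P m = 0"
    unfolding P_def M_def cs by (rule gegenbauer_shift_ODE)
  \<comment> \<open>The exponents \<open>m - 1\<close> and \<open>m - 2\<close> are truncated at
    zero, but only where the factor \<open>M\<close> or \<open>M * (M - 1)\<close> vanishes.\<close>
  have q2: "M * (M - 1) * (q ^ (m - 2) * q) = M * (M - 1) * q ^ (m - 1)"
    by (cases m rule: nat.exhaust; cases "m - 1") (auto simp: M_def)
  have q1: "M * (q ^ (m - 1) * q) = M * q ^ m"
    by (cases m) (auto simp: M_def)
  define U where "U = M * q ^ (m - 1)"
  have U: "U * (sin b - sin a * q) = U * sin b - M * q ^ m * sin a"
    unfolding q1[symmetric] U_def by (simp add: algebra_simps)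
  have "sin a * (M * (M - 1) * q ^ (m - 2) * (cos a * sin b)\<^sup>2 * P m - M * q ^ m * P m
      - 4 * M * (k + M) * q ^ (m - 1) * cos a * sin b * s * P (m + 1)
      - 2 * (k + M) * q ^ m * c * P (m + 1)
      + 4 * (k + M) * (k + M + 1) * q ^ m * s\<^sup>2 * P (m + 2))
    + 2 * k * cos a * (M * q ^ (m - 1) * cos a * sin b * P m
      - 2 * (k + M) * q ^ m * s * P (m + 1))
    + real j * (real j + 2 * k) * sin a * (q ^ m * P m)
   = M * (M - 1) * q ^ (m - 2) * (sin a * (cos a * sin b)\<^sup>2) * P m - sin a * M * q ^ m * P m
      - 4 * M * (k + M) * q ^ (m - 1) * (sin a * (cos a * sin b * s)) * P (m + 1)
      - 2 * (k + M) * q ^ m * sin a * c * P (m + 1)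
      + 4 * (k + M) * (k + M + 1) * q ^ m * sin a * s\<^sup>2 * P (m + 2)
      + 2 * k * M * q ^ (m - 1) * (cos a * (cos a * sin b)) * P m
      - 4 * k * (k + M) * q ^ m * (cos a * s) * P (m + 1)
      + real j * (real j + 2 * k) * sin a * (q ^ m * P m)"
    by (simp add: algebra_simps)
  also have "\<dots> = (M * (M - 1) * (q ^ (m - 2) * q)) * (sin b - sin a * q) * P m - sin a * M * q ^ m * P m
      - 4 * (k + M) * (M * (q ^ (m - 1) * q)) * (sin a * c - sin b) * P (m + 1)
      - 2 * (k + M) * q ^ m * sin a * c * P (m + 1)
      + 4 * (k + M) * (k + M + 1) * q ^ m * sin a * (1 - c\<^sup>2) * P (m + 2)
      + 2 * k * M * q ^ (m - 1) * (sin b - sin a * q) * P m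
      - 4 * k * (k + M) * q ^ m * (sin a * c - sin b) * P (m + 1)
      + real j * (real j + 2 * k) * sin a * (q ^ m * P m)"
    unfolding e1 e2 e3 e4 trig(3) by (simp only: ac_simps)
  also have "\<dots> = (M - 1) * (U * (sin b - sin a * q)) * P m - sin a * M * q ^ m * P m
      - 4 * (k + M) * (M * q ^ m) * (sin a * c - sin b) * P (m + 1)
      - 2 * (k + M) * q ^ m * sin a * c * P (m + 1)
      + 4 * (k + M) * (k + M + 1) * q ^ m * sin a * (1 - c\<^sup>2) * P (m + 2)
      + 2 * k * (U * (sin b - sin a * q)) * P m
      - 4 * k * (k + M) * q ^ m * (sin a * c - sin b) * P (m + 1)
      + real j * (real j + 2 * k) * sin a * (q ^ m * P m)"
    unfolding q2 q1 U_def by (simp only: ac_simps)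
  also have "\<dots> = sin b * ((M - 1 + 2 * k) * U * P m + 4 * (k + M)\<^sup>2 * q ^ m * P (m + 1))
     + sin a * q ^ m * ((1 - c\<^sup>2) * (4 * (k + M) * (k + M + 1)) * P (m + 2)
    - 2 * (k + M) * (2 * (k + M) + 1) * c * P (m + 1)
    + (real j - M) * (real j + M + 2 * k) * P m)"
    unfolding U by (simp add: algebra_simps power2_eq_square)
  finally show ?thesis
    unfolding O unfolding cs U_def by (simp add: mult_ac)
qed

lemma gegenbauer_product_ODE:
  assumes k: "k > 0"
  obtains h' h'' where
    "\<And>a. (gegenbauer_product k j b has_real_derivative h' a) (at a)"
    "\<And>a. (h' has_real_derivative h'' a) (at a)"
    "\<And>a. sin a * h'' a + 2 * k * cos a * h' a
      + real j * (real j + 2 * k) * sin a * gegenbauer_product k j b a = 0"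
proof -
  define q where "q = (\<lambda>a. sin a * sin b)"
  define P where "P = (\<lambda>m a. gegenbauer_shift k j m (cos (a - b)))"
  define d where "d = gegenbauer_product_coeff k"
  define t1 where "t1 = (\<lambda>m a. real m * q a ^ (m - 1) * cos a * sin b * P m a
      - 2 * (k + real m) * q a ^ m * sin (a - b) * P (m + 1) a)"
  define t2 where "t2 = (\<lambda>m a. real m * (real m - 1) * q a ^ (m - 2) * (cos a * sin b)\<^sup>2 * P m a
      - real m * q a ^ m * P m a
      - 4 * real m * (k + real m) * q a ^ (m - 1) * cos a * sin b * sin (a - b) * P (m + 1) a
      - 2 * (k + real m) * q a ^ m * cos (a - b) * P (m + 1) a
      + 4 * (k + real m) * (k + real m + 1) * q a ^ m * (sin (a - b))\<^sup>2 * P (m + 2) a)"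
  have dP: "(P m has_real_derivative - 2 * (k + real m) * sin (a - b) * P (m + 1) a) (at a)" for m a
    unfolding P_def
    by (rule DERIV_cong, rule gegenbauer_shift_deriv_chain, (rule derivative_eq_intros refl)+)
      (simp add: algebra_simps)
  have dq: "(q has_real_derivative cos a * sin b) (at a)" for a
    unfolding q_def by (auto intro!: derivative_eq_intros)
  have D1: "((\<lambda>a. q a ^ m * P m a) has_real_derivative t1 m a) (at a)" for m a
    unfolding t1_def by (rule derivative_eq_intros dP dq refl)+ (simp add: algebra_simps)
  have D2: "(t1 m has_real_derivative t2 m a) (at a)" for m a
  proof -
    consider "m = 0" | "m = 1" | i where "m = Suc (Suc i)"
      by (metis One_nat_def not0_implies_Suc)
    then show ?thesis
    proof cases
      case 1
      show ?thesis unfolding t1_def t2_def 1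
        by (rule derivative_eq_intros dP dq refl)+ (simp add: algebra_simps power2_eq_square)
    next
      case 2
      show ?thesis unfolding t1_def t2_def 2
        by (rule derivative_eq_intros dP dq refl)+ (simp add: algebra_simps power2_eq_square q_def)
    next
      case 3
      show ?thesis unfolding t1_def t2_def 3
        by (rule derivative_eq_intros dP dq refl)+ (simp add: algebra_simps power2_eq_square q_def)
    qed
  qed
  show ?thesis
  proof (rule that)
    fix a
    show "(gegenbauer_product k j b has_real_derivative (\<Sum>m\<le>j. d m * t1 m a)) (at a)"
      using D1 unfolding gegenbauer_product_def[abs_def] P_def q_def d_def
      by (intro DERIV_sum DERIV_cmult)
    show "((\<lambda>a. \<Sum>m\<le>j. d m * t1 m a) has_real_derivative (\<Sum>m\<le>j. d m * t2 m a)) (at a)"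
      by (intro DERIV_sum DERIV_cmult D2)
    \<comment> \<open>By the ratio of consecutive coefficients the \<open>m\<close>-th summand
      becomes \<open>sin b * (T m - T (Suc m))\<close>. Both ends of the telescope vanish:
      \<open>T 0\<close> through its factor \<open>m\<close>, and \<open>T (Suc j)\<close> because
      the shift exceeds the degree \<open>j\<close>.\<close>
    define T where "T = (\<lambda>m. d m * real m * (real m - 1 + 2 * k) * q a ^ (m - 1) * P m a)"
    have "sin a * (\<Sum>m\<le>j. d m * t2 m a) + 2 * k * cos a * (\<Sum>m\<le>j. d m * t1 m a)
        + real j * (real j + 2 * k) * sin a * gegenbauer_product k j b a
      = (\<Sum>m\<le>j. d m * (sin a * t2 m a + 2 * k * cos a * t1 m a
          + real j * (real j + 2 * k) * sin a * (q a ^ m * P m a)))"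
      unfolding gegenbauer_product_def sum_distrib_left d_def[symmetric] P_def q_def sum.distrib[symmetric]
      by (intro sum.cong refl) (simp add: algebra_simps)
    also have "\<dots> = (\<Sum>m\<le>j. d m * (sin b * (real m * (real m - 1 + 2 * k) * q a ^ (m - 1) * P m a
          + 4 * (k + real m)\<^sup>2 * q a ^ m * P (m + 1) a)))"
      using gegenbauer_product_term_ODE[of a _ b k j]
      unfolding t1_def t2_def P_def q_def by simp
    also have "\<dots> = (\<Sum>m\<le>j. sin b * (T m - T (Suc m)))"
    proof (intro sum.cong refl)
      fix m
      have "T (Suc m) = (d (Suc m) * (real (Suc m) * (2 * k + real m))) * q a ^ m * P (m + 1) a"
        by (simp add: T_def add_ac)
      also have "\<dots> = - 4 * (k + real m)\<^sup>2 * d m * q a ^ m * P (m + 1) a"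
        unfolding d_def gegenbauer_product_coeff_Suc[OF k] ..
      finally have T: "T (Suc m) = - 4 * (k + real m)\<^sup>2 * d m * q a ^ m * P (m + 1) a" .
      show "d m * (sin b * (real m * (real m - 1 + 2 * k) * q a ^ (m - 1) * P m a
          + 4 * (k + real m)\<^sup>2 * q a ^ m * P (m + 1) a)) = sin b * (T m - T (Suc m))"
        unfolding T unfolding T_def by (simp add: algebra_simps)
    qed
    also have "\<dots> = sin b * (T 0 - T (Suc j))"
      unfolding sum_distrib_left[symmetric] by (induction j) (auto simp: algebra_simps)
    also have "\<dots> = 0"
      by (simp add: T_def P_def gegenbauer_shift_eq)
    finally show "sin a * (\<Sum>m\<le>j. d m * t2 m a) + 2 * k * cos a * (\<Sum>m\<le>j. d m * t1 m a)
        + real j * (real j + 2 * k) * sin a * gegenbauer_product k j b a = 0" .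
  qed
qed

lemma gegenbauer_product_0_right: "gegenbauer_product k j b 0 = gegenbauer k j (cos b)"
  by (simp add: gegenbauer_product_def power_0_left if_distrib if_distribR
      gegenbauer_product_coeff_def gegenbauer_shift_eq sum.delta cong: if_cong)

text \<open>For \<open>b = 0\<close> only the term \<open>m = 0\<close> survives. Hence
  \<open>gegenbauer_product_ODE\<close> also provides the differential equation of the Gegenbauer
  polynomial itself in the angle.\<close>

lemma gegenbauer_product_0_left: "gegenbauer_product k j 0 a = gegenbauer k j (cos a)"
  by (simp add: gegenbauer_product_def power_0_left if_distrib if_distribR
      gegenbauer_product_coeff_def gegenbauer_shift_eq sum.delta cong: if_cong)

lemma gegenbauer_at_1_pos:
  assumes "k > 0"
  shows "gegenbauer k j 1 > 0"
  using assms by (simp add: gegenbauer_at_1 pochhammer_pos)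

text \<open>The energy estimate bounds the polynomial, as a function of the angle on
  \<open>{0..pi / 2}\<close>, by its value at angle \<open>0\<close>; parity covers negative
  cosines. The case \<open>j = 0\<close> is apart because \<open>?l\<close> must be positive to be
  divided out.\<close>

lemma abs_gegenbauer_cos_le:
  assumes k: "k > 0"
  shows "\<bar>gegenbauer k j (cos a)\<bar> \<le> gegenbauer k j 1"
proof (cases "j = 0")
  case False
  have *: "\<bar>gegenbauer k j x\<bar> \<le> gegenbauer k j 1" if x: "0 \<le> x" "x \<le> 1" for x
  proof -
    let ?l = "real j * (real j + 2 * k)"
    have l: "?l > 0" using False k by simp
    obtain h' h'' where h:
      "\<And>a. (gegenbauer_product k j 0 has_real_derivative h' a) (at a)"
      "\<And>a. (h' has_real_derivative h'' a) (at a)"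
      "\<And>a. sin a * h'' a + 2 * k * cos a * h' a + ?l * sin a * gegenbauer_product k j 0 a = 0"
      using gegenbauer_product_ODE[OF k, of j 0] by blast
    have "arccos x \<in> {0..pi / 2}"
      using x arccos_le_pi2[of x] arccos_lbound[of x] by simp
    from energy_bound[OF k h this]
    have "?l * (gegenbauer k j x)\<^sup>2 + (h' (arccos x))\<^sup>2 \<le> ?l * (gegenbauer k j 1)\<^sup>2"
      using x by (simp only: gegenbauer_product_0_left) simp
    then have "?l * (gegenbauer k j x)\<^sup>2 \<le> ?l * (gegenbauer k j 1)\<^sup>2"
      by (smt (verit) zero_le_power2)
    then have "(gegenbauer k j x)\<^sup>2 \<le> (gegenbauer k j 1)\<^sup>2"
      using l by (simp only: mult_le_cancel_left_pos)
    then show ?thesis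
      using gegenbauer_at_1_pos[OF k, of j] by (simp add: abs_le_square_iff[symmetric])
  qed
  show ?thesis
  proof (cases "cos a \<ge> 0")
    case True
    then show ?thesis by (intro *) auto
  next
    case False
    then show ?thesis
      using *[of "- cos a"] by (simp add: gegenbauer_uminus abs_mult)
  qed
qed auto

lemma gegenbauer_product_formula_aux:
  assumes k: "k > 0" and a: "a \<in> {0..pi / 2}"
  shows "gegenbauer k j (cos a) * gegenbauer k j (cos b) / gegenbauer k j 1 = gegenbauer_product k j b a"
proof -
  let ?l = "real j * (real j + 2 * k)"
  define c where "c = gegenbauer k j (cos b) / gegenbauer k j 1"
  obtain f' f'' where f:
    "\<And>a. (gegenbauer_product k j b has_real_derivative f' a) (at a)"
    "\<And>a. (f' has_real_derivative f'' a) (at a)"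
    "\<And>a. sin a * f'' a + 2 * k * cos a * f' a + ?l * sin a * gegenbauer_product k j b a = 0"
    using gegenbauer_product_ODE[OF k, of j b] by blast
  obtain g' g'' where g:
    "\<And>a. (gegenbauer_product k j 0 has_real_derivative g' a) (at a)"
    "\<And>a. (g' has_real_derivative g'' a) (at a)"
    "\<And>a. sin a * g'' a + 2 * k * cos a * g' a + ?l * sin a * gegenbauer_product k j 0 a = 0"
    using gegenbauer_product_ODE[OF k, of j 0] by blast
  define h where "h = (\<lambda>a. gegenbauer_product k j b a - c * gegenbauer_product k j 0 a)"
  define h' where "h' = (\<lambda>a. f' a - c * g' a)"
  have h: "(h has_real_derivative h' a) (at a)" for a
    unfolding h_def h'_def by (intro DERIV_diff DERIV_cmult f g)
  have h': "(h' has_real_derivative (f'' a - c * g'' a)) (at a)" for a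
    unfolding h'_def by (intro DERIV_diff DERIV_cmult f g)
  have ode: "sin a * (f'' a - c * g'' a) + 2 * k * cos a * h' a + ?l * sin a * h a = 0" for a
    using f(3)[of a] g(3)[of a] unfolding h_def h'_def by algebra
  have h0: "h 0 = 0"
    using gegenbauer_at_1_pos[OF k, of j]
    by (simp add: h_def c_def gegenbauer_product_0_right)
  \<comment> \<open>Only \<open>h'\<close> is read off from the energy: for \<open>j = 0\<close> the
    factor \<open>?l\<close> is \<open>0\<close> and the bound says nothing about \<open>h\<close>.
    That \<open>h\<close> vanishes then follows from its being constant with
    \<open>h 0 = 0\<close>.\<close>
  have z: "h' x = 0" if "x \<in> {0..pi / 2}" for x
  proof -
    have "?l * (h x)\<^sup>2 + (h' x)\<^sup>2 \<le> 0"
      using energy_bound[OF k h h' ode that] h0 by simp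
    moreover have "?l * (h x)\<^sup>2 \<ge> 0" using k by simp
    ultimately show ?thesis by (smt (verit) zero_less_power2)
  qed
  have "h a = h 0"
  proof (cases "a = 0")
    case False
    show ?thesis
    proof (rule DERIV_isconst_end[of 0 a h])
      show "\<And>x. 0 < x \<Longrightarrow> x < a \<Longrightarrow> (h has_real_derivative 0) (at x)"
        using h z a by (metis atLeastAtMost_iff less_eq_real_def order_trans)
      show "continuous_on {0..a} h"
        using h by (meson DERIV_continuous_on has_field_derivative_at_within)
    qed (use a False in auto)
  qed auto
  then show ?thesis
    by (simp add: h0) (simp add: h_def c_def gegenbauer_product_0_left)
qed

text \<open>Angles beyond \<open>pi / 2\<close> are reflected: replacing \<open>a\<close> and
  \<open>b\<close> by their supplements leaves \<open>gegenbauer_product\<close> unchanged, and the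
  two signs \<open>(-1)^j\<close> on the left cancel.\<close>

theorem gegenbauer_product_formula:
  assumes k: "k > 0" and a: "a \<in> {0..pi}"
  shows "gegenbauer k j (cos a) * gegenbauer k j (cos b) / gegenbauer k j 1 = gegenbauer_product k j b a"
proof (cases "a \<le> pi / 2")
  case True
  with a k show ?thesis by (intro gegenbauer_product_formula_aux) auto
next
  case False
  have "gegenbauer_product k j (pi - b) (pi - a) = gegenbauer_product k j b a"
    by (simp add: gegenbauer_product_def cos_diff add.commute mult.commute)
  moreover have sq: "((- 1) ^ j * A) * ((- 1) ^ j * B) = A * B" for A B :: real
  proof -
    have "(- 1) ^ j * (- 1) ^ j = (1 :: real)"
      by (simp flip: power_mult_distrib)
    moreover have "((- 1) ^ j * A) * ((- 1) ^ j * B) = ((- 1) ^ j * (- 1) ^ j) * (A * B)"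
      by (simp only: ac_simps)
    ultimately show ?thesis by simp
  qed
  ultimately show ?thesis
    using gegenbauer_product_formula_aux[OF k, of "pi - a" j "pi - b"] False a
    by (simp add: gegenbauer_uminus sq)
qed

section \<open>Change of variable $x = w / (1 + w^2)$\<close>

text \<open>Pascal's rule in the language of finite differences: one of the \<open>p + 1\<close>
  differences is carried out on \<open>f\<close>.\<close>

lemma alternating_binomial_sum_Suc:
  fixes f :: "nat \<Rightarrow> real"
  shows "(\<Sum>m\<le>Suc p. (- 1) ^ m * real (Suc p choose m) * f m) =
    (\<Sum>m\<le>p. (- 1) ^ m * real (p choose m) * (f m - f (Suc m)))"
proof -
  have "(\<Sum>m\<le>Suc p. (- 1) ^ m * real (Suc p choose m) * f m) =
      f 0 + (\<Sum>m\<le>p. (- 1) ^ Suc m * real (p choose Suc m) * f (Suc m))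
      + (\<Sum>m\<le>p. (- 1) ^ Suc m * real (p choose m) * f (Suc m))"
    by (subst sum.atMost_Suc_shift) (simp add: algebra_simps flip: sum.distrib)
  also have "f 0 + (\<Sum>m\<le>p. (- 1) ^ Suc m * real (p choose Suc m) * f (Suc m)) =
      (\<Sum>m\<le>Suc p. (- 1) ^ m * real (p choose m) * f m)"
    by (subst sum.atMost_Suc_shift) simp
  also have "\<dots> = (\<Sum>m\<le>p. (- 1) ^ m * real (p choose m) * f m)"
    by simp
  finally show ?thesis
    by (simp add: algebra_simps sum.distrib sum_negf sum_subtractf)
qed

text \<open>The sum is a \<open>p\<close>-th finite difference of a polynomial in \<open>m\<close>
  of degree \<open>q < p\<close>. A difference of a rising factorial is a multiple of one with one
  factor fewer, which drives the induction.\<close>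

lemma alternating_pochhammer_sum:
  fixes a :: real
  assumes "q < p"
  shows "(\<Sum>m\<le>p. (- 1) ^ m * real (p choose m) * pochhammer (a + real m) q) = 0"
  using assms
proof (induction p arbitrary: a q)
  case (Suc p)
  show ?case
  proof (cases q)
    case 0
    then show ?thesis unfolding alternating_binomial_sum_Suc by simp
  next
    case (Suc r)
    have "pochhammer x (Suc r) - pochhammer (x + 1) (Suc r) = - real (Suc r) * pochhammer (x + 1) r"
      for x :: real
      unfolding pochhammer_rec[of x] pochhammer_Suc[of "x + 1"] by (simp add: algebra_simps)
    from this[of "a + real _"]
    have "(\<Sum>m\<le>Suc p. (- 1) ^ m * real (Suc p choose m) * pochhammer (a + real m) q) =
      (\<Sum>m\<le>p. (- 1) ^ m * real (p choose m) * (- real (Suc r) * pochhammer ((a + 1) + real m) r))"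
      unfolding alternating_binomial_sum_Suc Suc by (simp add: ac_simps)
    also have "\<dots> = - real (Suc r) * (\<Sum>m\<le>p. (- 1) ^ m * real (p choose m) * pochhammer ((a + 1) + real m) r)"
      unfolding sum_distrib_left by (intro sum.cong refl) (simp only: ac_simps)
    also have "\<dots> = 0"
      using Suc.IH[of r "a + 1"] Suc.prems Suc by simp
    finally show ?thesis .
  qed
qed simp

text \<open>The coefficients of the power series in \<open>x\<^sup>2\<close> of \<open>1 + w\<^sup>2\<close> to the power \<open>\<nu>\<close>,
  where \<open>x = w / (1 + w\<^sup>2)\<close>.\<close>
definition catalan_power_coeff :: "real \<Rightarrow> nat \<Rightarrow> real" where
  "catalan_power_coeff \<nu> m = \<nu> * Gamma (\<nu> + 2 * real m) / (fact m * Gamma (\<nu> + real m + 1))"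

text \<open>For \<open>p > 0\<close> the Gamma factors cancel so that each summand is a constant
  times \<open>(-1)^m * (p choose m) * pochhammer (\<nu> + 1 + m) (p - 1)\<close>: a
  \<open>p\<close>-th difference of a polynomial of degree \<open>p - 1\<close>. This takes the
  place of Lagrange inversion.\<close>

lemma catalan_power_coeff_sum:
  assumes \<nu>: "\<nu> > 0"
  shows "(\<Sum>m\<le>p. catalan_power_coeff \<nu> m * ((- (2 * real m + \<nu>)) gchoose (p - m))) = (if p = 0 then 1 else 0)"
proof (cases p)
  case 0
  have "Gamma (\<nu> + 1) = \<nu> * Gamma \<nu>"
    using \<nu> by (intro Gamma_plus1) (auto elim!: nonpos_Ints_cases)
  moreover have "Gamma (\<nu> + 1) > 0"
    using \<nu> by (intro Gamma_real_pos) auto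
  moreover have "Gamma \<nu> \<noteq> 0"
    using Gamma_real_pos[OF \<nu>] by linarith
  ultimately show ?thesis
    using 0 \<nu> by (simp add: catalan_power_coeff_def)
next
  case (Suc r)
  have "catalan_power_coeff \<nu> m * ((- (2 * real m + \<nu>)) gchoose (p - m)) =
     (- 1) ^ p * \<nu> / fact p * ((- 1) ^ m * real (p choose m) * pochhammer ((\<nu> + 1) + real m) r)"
    if m: "m \<le> p" for m
  proof -
    have G: "Gamma x > 0" if "x > 0" for x :: real
      using that by (rule Gamma_real_pos)
    have poch: "pochhammer x i = Gamma (x + real i) / Gamma x" if "x > 0" for x :: real and i
      using that by (intro pochhammer_Gamma) (auto elim!: nonpos_Ints_cases)
    have sgn: "(- 1) ^ (p - m) = (- 1) ^ p * (- 1 :: real) ^ m"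
      using m by (auto simp: minus_one_power_iff)
    have args: "2 * real m + \<nu> + real (p - m) = \<nu> + real m + real p"
      "(\<nu> + 1) + real m + real r = \<nu> + real m + real p"
      using m Suc by (simp_all add: of_nat_diff)
    have p1: "pochhammer (2 * real m + \<nu>) (p - m) = Gamma (\<nu> + real m + real p) / Gamma (2 * real m + \<nu>)"
      unfolding args(1)[symmetric] by (rule poch) (use \<nu> in auto)
    have p2: "pochhammer ((\<nu> + 1) + real m) r = Gamma (\<nu> + real m + real p) / Gamma (\<nu> + 1 + real m)"
      unfolding args(2)[symmetric] by (rule poch) (use \<nu> in auto)
    have ch: "real (p choose m) = fact p / (fact m * fact (p - m))"
      using m by (rule binomial_fact)
    have "Gamma (2 * real m + \<nu>) > 0"
      using \<nu> by (intro G) auto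
    then show ?thesis
      unfolding catalan_power_coeff_def gchoose_neg p1 p2 sgn ch by (simp add: field_simps)
  qed
  then have "(\<Sum>m\<le>p. catalan_power_coeff \<nu> m * ((- (2 * real m + \<nu>)) gchoose (p - m))) =
    (\<Sum>m\<le>p. (- 1) ^ p * \<nu> / fact p * ((- 1) ^ m * real (p choose m) * pochhammer ((\<nu> + 1) + real m) r))"
    by (intro sum.cong) auto
  also have "\<dots> = 0"
    unfolding sum_distrib_left[symmetric]
    by (subst alternating_pochhammer_sum) (use Suc in auto)
  finally show ?thesis using Suc by simp
qed

text \<open>In \<open>v = w^2\<close> the substitution reads \<open>x^2 = v / (1 + v)^2\<close>. Its
  \<open>m\<close>-th power times \<open>(1 + v)^(-\<nu>)\<close> is
  \<open>v^m (1 + v)^(-(2m + \<nu>))\<close>, so the coefficients of the product are the sums in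
  \<open>catalan_power_coeff_sum\<close> and the product is \<open>1\<close>.\<close>

lemma catalan_power_fps_compose:
  assumes \<nu>: "\<nu> > 0"
  shows "Abs_fps (catalan_power_coeff \<nu>) oo (fps_X * fps_binomial (- 2)) = fps_binomial \<nu>"
proof -
  define U :: "real fps" where "U = fps_X * fps_binomial (- 2)"
  define A where "A = Abs_fps (catalan_power_coeff \<nu>)"
  define R where "R = fps_binomial (- \<nu>)"
  have Upow: "U ^ m = fps_X ^ m * fps_binomial (- 2 * real m)" for m
    by (induction m) (auto simp: U_def algebra_simps fps_binomial_add_mult[symmetric])
  have "(A oo U) * R = 1"
  proof (rule fps_ext)
    fix p
    have A: "(A oo U) $ i = (\<Sum>m\<le>p. fps_const (catalan_power_coeff \<nu> m) * U ^ m) $ i" if "i \<le> p" for i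
    proof -
      have "(A oo U) $ i = (\<Sum>m\<in>{0..i}. catalan_power_coeff \<nu> m * (U ^ m $ i))"
        by (simp add: fps_compose_nth A_def)
      also have "\<dots> = (\<Sum>m\<le>p. catalan_power_coeff \<nu> m * (U ^ m $ i))"
        using that by (intro sum.mono_neutral_left) (auto simp: Upow fps_X_power_mult_nth)
      finally show ?thesis by (simp add: fps_sum_nth)
    qed
    have "((A oo U) * R) $ p = ((\<Sum>m\<le>p. fps_const (catalan_power_coeff \<nu> m) * U ^ m) * R) $ p"
      by (simp add: fps_mult_nth A)
    also have "\<dots> = (\<Sum>m\<le>p. catalan_power_coeff \<nu> m * (U ^ m * R) $ p)"
      by (simp add: sum_distrib_right fps_sum_nth mult.assoc)
    also have "\<dots> = (\<Sum>m\<le>p. catalan_power_coeff \<nu> m * ((- (2 * real m + \<nu>)) gchoose (p - m)))"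
    proof (intro sum.cong refl)
      fix m assume "m \<in> {..p}"
      have "U ^ m * R = fps_X ^ m * fps_binomial (- (2 * real m + \<nu>))"
        by (simp add: Upow R_def mult.assoc flip: fps_binomial_add_mult)
      then show "catalan_power_coeff \<nu> m * (U ^ m * R) $ p =
          catalan_power_coeff \<nu> m * ((- (2 * real m + \<nu>)) gchoose (p - m))"
        using \<open>m \<in> {..p}\<close> by (simp add: fps_X_power_mult_nth)
    qed
    finally show "((A oo U) * R) $ p = 1 $ p"
      using catalan_power_coeff_sum[OF \<nu>, of p] by simp
  qed
  then have "(A oo U) * (R * fps_binomial \<nu>) = fps_binomial \<nu>"
    by (simp only: mult.assoc[symmetric] mult_1_left)
  moreover have "R * fps_binomial \<nu> = 1"
    by (simp add: R_def flip: fps_binomial_add_mult)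
  ultimately show ?thesis
    by (simp add: A_def U_def)
qed

text \<open>With \<open>w = e\<^sup>-\<^sup>\<tau>\<close> this is \<open>1 / (2 cosh \<tau>)\<close>.\<close>
definition joukowski_fps :: "real fps" where
  "joukowski_fps = fps_X * fps_rpow (1 + fps_X\<^sup>2) (- 1)"

lemma one_plus_X2_nth_0: "(1 + fps_X\<^sup>2 :: real fps) $ 0 = 1"
  by simp

lemma joukowski_fps_mult: "(1 + fps_X\<^sup>2) * joukowski_fps = fps_X"
proof -
  have "(1 + fps_X\<^sup>2) * fps_rpow (1 + fps_X\<^sup>2) (- 1) = 1"
    using fps_rpow_add[OF one_plus_X2_nth_0, of 1 "- 1"] fps_rpow_of_nat[OF one_plus_X2_nth_0, of 1]
    by simp
  then show ?thesis
    by (simp add: joukowski_fps_def mult.left_commute)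
qed

lemma joukowski_fps_nth_0 [simp]: "joukowski_fps $ 0 = 0"
  and joukowski_fps_nth_1 [simp]: "joukowski_fps $ Suc 0 = 1"
  by (simp_all add: joukowski_fps_def)

lemma catalan_power_fps_joukowski:
  assumes \<nu>: "\<nu> > 0"
  shows "(Abs_fps (catalan_power_coeff \<nu>) oo fps_X\<^sup>2) oo joukowski_fps = fps_rpow (1 + fps_X\<^sup>2) \<nu>"
proof -
  have X2: "(fps_X\<^sup>2 :: real fps) $ 0 = 0" by simp
  have b: "fps_binomial a oo fps_X\<^sup>2 = fps_rpow (1 + fps_X\<^sup>2) a" for a
    by (simp add: fps_rpow_def)
  have "joukowski_fps\<^sup>2 = (fps_X * fps_binomial (- 2)) oo fps_X\<^sup>2"
  proof -
    have "joukowski_fps\<^sup>2 = fps_X\<^sup>2 * (fps_rpow (1 + fps_X\<^sup>2) (- 1) * fps_rpow (1 + fps_X\<^sup>2) (- 1))"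
      by (simp add: joukowski_fps_def power2_eq_square algebra_simps)
    also have "\<dots> = fps_X\<^sup>2 * fps_rpow (1 + fps_X\<^sup>2) (- 2)"
      by (subst fps_rpow_add[OF one_plus_X2_nth_0, symmetric]) simp
    finally show ?thesis
      by (simp add: fps_compose_mult_distrib[OF X2] b)
  qed
  then have "(fps_X\<^sup>2 oo joukowski_fps) = (fps_X * fps_binomial (- 2)) oo fps_X\<^sup>2"
    by (simp flip: fps_compose_power)
  then show ?thesis
    by (simp add: fps_compose_assoc[symmetric] b[symmetric])
      (simp add: fps_compose_assoc catalan_power_fps_compose[OF \<nu>])
qed

text \<open>The substituted series has linear coefficient \<open>1\<close>, hence a compositional
  inverse. That inverse is divisible by \<open>fps_X\<close>, so undoing the substitution turns the
  factor \<open>fps_X ^ M\<close> into another multiple of \<open>fps_X ^ M\<close>. Coefficients in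
  \<open>x\<close> may thus be compared after passing to \<open>w\<close>.\<close>

lemma fps_nth_eq_0_if_compose_joukowski:
  assumes "H oo joukowski_fps = fps_X ^ M * S" "N < M"
  shows "H $ N = 0"
proof -
  define W where "W = fps_inv joukowski_fps"
  have W0: "W $ 0 = 0" by (simp add: W_def fps_inv_def)
  have "W = fps_X * fps_shift 1 W"
    using W0 by (intro fps_ext) simp
  from arg_cong[OF this, of "\<lambda>x. x ^ M"]
  have W: "W ^ M = fps_X ^ M * fps_shift 1 W ^ M"
    by (simp add: power_mult_distrib)
  have "joukowski_fps oo W = fps_X"
    unfolding W_def by (rule fps_inv_right) simp_all
  then have "H = (H oo joukowski_fps) oo W"
    by (simp add: fps_compose_assoc[symmetric] W0)
  also have "\<dots> = W ^ M * (S oo W)"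
    unfolding assms(1) using W0 by (simp add: fps_compose_mult_distrib flip: fps_compose_power)
  finally have "H = fps_X ^ M * (fps_shift 1 W ^ M * (S oo W))"
    by (simp only: W mult.assoc)
  then show ?thesis
    using assms(2) by (metis fps_X_power_mult_nth)
qed

section \<open>Factorization of the trinomial over rotated roots of unity\<close>

lemma prod_one_minus_roots_unity:
  fixes y :: complex
  assumes n: "n > 0"
  shows "(\<Prod>s<n. 1 - cis (2 * pi * real s / real n) * y) = 1 - y ^ n"
proof (cases "y = 0")
  case False
  define z where "z = (\<lambda>s. cis (2 * pi * real s / real n))"
  define p where "p = (\<Prod>s<n. [:- z s, 1:])"
  have bij: "bij_betw z {..<n} {z. z ^ n = 1}"
    unfolding z_def by (rule Complex.bij_betw_roots_unity[OF n])
  have deg: "degree p = n"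
    unfolding p_def by (subst degree_prod_eq_sum_degree) auto
  have "p = monom 1 n - 1"
  proof (rule poly_eqI_degree_lead_coeff[where n = n and A = "{z. z ^ n = 1}"])
    have "lead_coeff p = 1"
      unfolding p_def by (subst lead_coeff_prod) simp
    then show "coeff p n = coeff (monom 1 n - 1) n"
      using deg n by simp
    show "n \<le> card {z :: complex. z ^ n = 1}"
      using card_roots_unity_eq[OF n] by simp
    show "degree p \<le> n" using deg by simp
    show "degree (monom 1 n - 1 :: complex poly) \<le> n"
      by (intro degree_diff_le) (auto simp: degree_monom_le)
    fix x :: complex assume "x \<in> {z. z ^ n = 1}"
    moreover from this obtain s where "s < n" "x = z s"
      using bij by (auto simp: bij_betw_def)
    ultimately show "poly p x = poly (monom 1 n - 1) x"
      by (auto simp: p_def poly_prod poly_monom)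
  qed
  then have "poly p (1 / y) = (1 / y) ^ n - 1"
    by (simp add: poly_monom)
  then have "y ^ n * (\<Prod>s<n. 1 / y - z s) = y ^ n * ((1 / y) ^ n - 1)"
    by (simp add: p_def poly_prod)
  moreover have "y ^ n * (\<Prod>s<n. 1 / y - z s) = (\<Prod>s<n. y * (1 / y - z s))"
    by (simp add: prod.distrib)
  moreover have "(\<Prod>s<n. y * (1 / y - z s)) = (\<Prod>s<n. 1 - z s * y)"
    using False by (intro prod.cong) (auto simp: field_simps)
  moreover have "y ^ n * ((1 / y) ^ n - 1) = 1 - y ^ n"
    using False by (simp add: power_divide right_diff_distrib)
  ultimately show ?thesis
    by (simp only: z_def)
qed (use n in \<open>simp add: power_0_left\<close>)

text \<open>Each factor is \<open>1 - e^(it) w\<close> times its conjugate, and over the rotated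
  roots of unity these linear factors multiply to \<open>1 - (e^(i \<psi>) w)^n\<close>.\<close>

lemma prod_quadratic_rotated_cos:
  fixes w \<psi> :: real
  assumes n: "n > 0"
  shows "(\<Prod>s<n. 1 - 2 * cos (\<psi> + 2 * pi * real s / real n) * w + w\<^sup>2) =
    1 - 2 * cos (real n * \<psi>) * w ^ n + w ^ (2 * n)"
proof -
  have *: "complex_of_real (1 - 2 * cos t * w + w\<^sup>2) = (1 - cis t * of_real w) * cnj (1 - cis t * of_real w)"
    for t w by (simp add: complex_eq_iff algebra_simps power2_eq_square flip: distrib_left)
  let ?t = "\<lambda>s. \<psi> + 2 * pi * real s / real n"
  have P: "(\<Prod>s<n. 1 - cis (?t s) * of_real w) = 1 - (cis \<psi> * of_real w) ^ n"
    using prod_one_minus_roots_unity[OF n, of "cis \<psi> * of_real w"]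
    by (simp add: cis_mult mult.assoc[symmetric] add.commute)
  have "complex_of_real (\<Prod>s<n. 1 - 2 * cos (?t s) * w + w\<^sup>2) =
      (\<Prod>s<n. 1 - cis (?t s) * of_real w) * cnj (\<Prod>s<n. 1 - cis (?t s) * of_real w)"
    unfolding of_real_prod * by (simp add: prod.distrib)
  also have "\<dots> = (1 - cis (real n * \<psi>) * of_real (w ^ n)) * cnj (1 - cis (real n * \<psi>) * of_real (w ^ n))"
    unfolding P by (simp add: power_mult_distrib Complex.DeMoivre)
  also have "\<dots> = complex_of_real (1 - 2 * cos (real n * \<psi>) * w ^ n + (w ^ n)\<^sup>2)"
    by (simp only: *)
  also have "(w ^ n)\<^sup>2 = w ^ (2 * n)"
    by (simp add: power_mult[symmetric] mult.commute)
  finally show ?thesis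
    by (simp only: of_real_eq_iff)
qed


lemma prod_quadratic_rotated_cos_fps:
  assumes n: "n > 0"
  shows "(\<Prod>s<n. 1 - fps_const (2 * cos (\<psi> + 2 * pi * real s / real n)) * fps_X + fps_X\<^sup>2) =
    1 - fps_const (2 * cos (real n * \<psi>)) * fps_X ^ n + fps_X ^ (2 * n)"
proof -
  let ?c = "\<lambda>s. 2 * cos (\<psi> + 2 * pi * real s / real n)"
  define p where "p = (\<Prod>s<n. [:1, - ?c s, 1:])"
  define q where "q = 1 - smult (2 * cos (real n * \<psi>)) (monom 1 n) + monom 1 (2 * n)"
  have "poly p w = poly q w" for w
    using prod_quadratic_rotated_cos[OF n, of \<psi> w]
    by (simp add: p_def q_def poly_prod poly_monom algebra_simps power2_eq_square)
  then have "fps_of_poly p = fps_of_poly q"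
    by (metis poly_eq_poly_eq_iff ext)
  moreover have "fps_of_poly [:1, - ?c s, 1:] = 1 - fps_const (?c s) * fps_X + fps_X\<^sup>2" for s
    by (simp add: fps_of_poly_pCons algebra_simps power2_eq_square flip: fps_const_neg)
  moreover have "fps_of_poly p = (\<Prod>s<n. fps_of_poly [:1, - ?c s, 1:])"
    unfolding p_def by (rule fps_of_poly_prod)
  moreover have "fps_of_poly q = 1 - fps_const (2 * cos (real n * \<psi>)) * fps_X ^ n + fps_X ^ (2 * n)"
    by (simp add: q_def fps_of_poly_simps fps_of_poly_monom' fps_of_poly_smult)
  ultimately show ?thesis by simp
qed

text \<open>Multiplying every linear factor by \<open>1 + w^2\<close> produces the quadratics whose
  product is the trinomial, that is, the denominator of the Gegenbauer generating function at
  \<open>w^n\<close>. The \<open>n\<close> factors introduced on the way are given back as the power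
  \<open>n * a\<close> of \<open>1 + w^2\<close>.\<close>

lemma prod_linear_compose_joukowski:
  assumes n: "n > 0"
  shows "(\<Prod>s<n. fps_rpow (1 - fps_const (2 * cos (\<psi> + 2 * pi * real s / real n)) * fps_X) (- a))
      oo joukowski_fps =
    fps_rpow (1 + fps_X\<^sup>2) (real n * a) * (gegenbauer_gf a (cos (real n * \<psi>)) oo fps_X ^ n)"
proof -
  let ?c = "\<lambda>s. fps_const (2 * cos (\<psi> + 2 * pi * real s / real n))"
  let ?J = "joukowski_fps" and ?E = "1 + fps_X\<^sup>2 :: real fps"
  let ?f = "1 - fps_const (2 * cos (real n * \<psi>)) * fps_X + fps_X\<^sup>2 :: real fps"
  define P where "P = (\<Prod>s<n. 1 - ?c s * ?J)"
  have Xn: "(fps_X ^ n :: real fps) $ 0 = 0" using n by simp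
  have P0: "P $ 0 = 1" by (simp add: P_def fps_nth_prod_0)
  have f0: "?f $ 0 = 1" by (simp add: power2_eq_square)
  have "?E ^ n * P = (\<Prod>s<n. ?E * (1 - ?c s * ?J))"
    by (simp add: P_def prod.distrib)
  also have "\<dots> = (\<Prod>s<n. 1 - ?c s * fps_X + fps_X\<^sup>2)"
  proof (intro prod.cong refl)
    fix s
    have "?E * (1 - ?c s * ?J) = ?E - ?c s * (?E * ?J)"
      by (simp add: algebra_simps)
    then show "?E * (1 - ?c s * ?J) = 1 - ?c s * fps_X + fps_X\<^sup>2"
      unfolding joukowski_fps_mult by simp
  qed
  also have "\<dots> = ?f oo fps_X ^ n"
    unfolding prod_quadratic_rotated_cos_fps[OF n]
    by (simp add: fps_compose_add_distrib fps_compose_sub_distrib fps_compose_mult_distrib[OF Xn]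
        fps_X_fps_compose_startby0[OF Xn] power_mult mult.commute[of 2] flip: fps_compose_power[OF Xn])
  finally have "fps_rpow (?E ^ n * P) (- a) = fps_rpow (?f oo fps_X ^ n) (- a)"
    by simp
  then have "fps_rpow ?E (- (real n * a)) * fps_rpow P (- a) = gegenbauer_gf a (cos (real n * \<psi>)) oo fps_X ^ n"
    using Xn f0 P0 unfolding gegenbauer_gf_def
    by (simp add: fps_rpow_mult fps_rpow_power fps_rpow_compose fps_power_zeroth)
  then have "fps_rpow ?E (real n * a) * (fps_rpow ?E (- (real n * a)) * fps_rpow P (- a)) =
      fps_rpow ?E (real n * a) * (gegenbauer_gf a (cos (real n * \<psi>)) oo fps_X ^ n)"
    by simp
  moreover have "fps_rpow ?E (real n * a) * fps_rpow ?E (- (real n * a)) = 1"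
    by (subst fps_rpow_add[OF one_plus_X2_nth_0, symmetric]) simp
  ultimately have "fps_rpow P (- a) = fps_rpow ?E (real n * a) * (gegenbauer_gf a (cos (real n * \<psi>)) oo fps_X ^ n)"
    by (simp flip: mult.assoc)
  moreover have "(\<Prod>s<n. fps_rpow (1 - ?c s * fps_X) (- a)) oo ?J = fps_rpow P (- a)"
    unfolding P_def
    by (simp add: fps_compose_prod_distrib fps_rpow_compose fps_rpow_prod fps_compose_sub_distrib
        fps_compose_mult_distrib)
  ultimately show ?thesis by simp
qed

section \<open>Comparison of coefficients after the substitution\<close>

lemma sum_upto_gegenbauer_gf_nth:
  assumes "i \<le> N"
  shows "(\<Sum>m\<le>N. fps_const (gegenbauer_product_coeff k m * (sin a * sin b) ^ m) *
      (fps_X ^ m * gegenbauer_gf (k + real m) (cos (a - b)))) $ i = gegenbauer_product k i b a"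
proof -
  have "(\<Sum>m\<le>N. fps_const (gegenbauer_product_coeff k m * (sin a * sin b) ^ m) *
      (fps_X ^ m * gegenbauer_gf (k + real m) (cos (a - b)))) $ i =
    (\<Sum>m\<le>N. gegenbauer_product_coeff k m * ((sin a * sin b) ^ m * gegenbauer_shift k i m (cos (a - b))))"
    by (simp add: fps_sum_nth gegenbauer_shift_def mult.assoc)
  also have "\<dots> = gegenbauer_product k i b a"
    unfolding gegenbauer_product_def using assms
    by (intro sum.mono_neutral_right) (auto simp: gegenbauer_shift_eq)
  finally show ?thesis .
qed

theorem gegenbauer_simplex_coefficients:
  assumes n: "n > 0" and k: "k > 0"
  shows "(\<Sum>m\<le>N. fps_const (gegenbauer_product_coeff k m * (sin (real n * \<phi>) * sin (real n * \<theta>)) ^ m) *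
      (fps_X ^ (n * m) * (\<Prod>s<n. fps_rpow (1 - fps_const (2 * cos (\<theta> - \<phi> + 2 * pi * real s / real n)) * fps_X)
        (- (k + real m))))) $ N =
    (\<Sum>j\<le>N. fps_const (gegenbauer_product k j (real n * \<theta>) (real n * \<phi>)) *
      (fps_X ^ (n * j) * (Abs_fps (catalan_power_coeff (real n * (k + real j))) oo fps_X\<^sup>2))) $ N"
    (is "?R $ N = ?L $ N")
proof -
  let ?J = "joukowski_fps" and ?E = "1 + fps_X\<^sup>2 :: real fps"
  define a b where ab: "a = real n * \<phi>" "b = real n * \<theta>"
  define D where "D = (\<Sum>m\<le>N. fps_const (gegenbauer_product_coeff k m * (sin a * sin b) ^ m) *
      (fps_X ^ m * gegenbauer_gf (k + real m) (cos (a - b))))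
    - (\<Sum>j\<le>N. fps_const (gegenbauer_product k j b a) * fps_X ^ j)"
  have Xn: "(fps_X ^ n :: real fps) $ 0 = 0" using n by simp
  have cos: "cos (real n * (\<theta> - \<phi>)) = cos (a - b)"
    unfolding ab right_diff_distrib[symmetric] by (metis cos_minus minus_diff_eq mult_minus_right)
  \<comment> \<open>The powers of \<open>1 + w^2\<close> beyond \<open>n * k\<close> cancel the
    denominators in \<open>(w / (1 + w^2))^(n m)\<close>. The prefactor left over is independent of
    the summation index, in both sums.\<close>
  have J: "?J ^ (n * m) * fps_rpow ?E (real n * (k + real m)) = fps_rpow ?E (real n * k) * fps_X ^ (n * m)" for m
  proof -
    have "fps_rpow ?E (real n * (k + real m)) = fps_rpow ?E (real n * k) * ?E ^ (n * m)"
      unfolding fps_rpow_of_nat[OF one_plus_X2_nth_0, symmetric]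
      by (subst fps_rpow_add[OF one_plus_X2_nth_0, symmetric]) (simp add: algebra_simps)
    then have "?J ^ (n * m) * fps_rpow ?E (real n * (k + real m)) =
        fps_rpow ?E (real n * k) * (?E * ?J) ^ (n * m)"
      by (simp add: power_mult_distrib ac_simps)
    then show ?thesis unfolding joukowski_fps_mult .
  qed
  have "?R oo ?J = fps_rpow ?E (real n * k) *
    ((\<Sum>m\<le>N. fps_const (gegenbauer_product_coeff k m * (sin a * sin b) ^ m) *
      (fps_X ^ m * gegenbauer_gf (k + real m) (cos (a - b)))) oo fps_X ^ n)"
    unfolding fps_compose_sum_distrib sum_distrib_left
  proof (intro sum.cong refl)
    fix m
    let ?c = "fps_const (gegenbauer_product_coeff k m * (sin a * sin b) ^ m)"
    let ?P = "\<Prod>s<n. fps_rpow (1 - fps_const (2 * cos (\<theta> - \<phi> + 2 * pi * real s / real n)) * fps_X)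
        (- (k + real m))"
    have "?c * (fps_X ^ (n * m) * ?P) oo ?J = ?c * (?J ^ (n * m) * (?P oo ?J))"
      by (simp add: fps_compose_mult_distrib fps_compose_power[symmetric])
    also have "\<dots> = ?c * ((?J ^ (n * m) * fps_rpow ?E (real n * (k + real m))) *
        (gegenbauer_gf (k + real m) (cos (a - b)) oo fps_X ^ n))"
      unfolding prod_linear_compose_joukowski[OF n] cos by (simp only: ac_simps)
    also have "\<dots> = fps_rpow ?E (real n * k) *
        (?c * (fps_X ^ m * gegenbauer_gf (k + real m) (cos (a - b))) oo fps_X ^ n)"
      unfolding J
      by (simp add: fps_compose_mult_distrib[OF Xn] fps_compose_power[OF Xn, symmetric]
          fps_X_fps_compose_startby0[OF Xn] power_mult)
    finally show "fps_const (gegenbauer_product_coeff k m * (sin (real n * \<phi>) * sin (real n * \<theta>)) ^ m) *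
      (fps_X ^ (n * m) * ?P) oo ?J = fps_rpow ?E (real n * k) *
        (?c * (fps_X ^ m * gegenbauer_gf (k + real m) (cos (a - b))) oo fps_X ^ n)"
      by (simp only: ab)
  qed
  moreover have "?L oo ?J = fps_rpow ?E (real n * k) *
    ((\<Sum>j\<le>N. fps_const (gegenbauer_product k j b a) * fps_X ^ j) oo fps_X ^ n)"
    unfolding fps_compose_sum_distrib sum_distrib_left
  proof (intro sum.cong refl)
    fix j
    let ?c = "fps_const (gegenbauer_product k j b a)"
    let ?A = "Abs_fps (catalan_power_coeff (real n * (k + real j))) oo fps_X\<^sup>2"
    have "real n * (k + real j) > 0" using n k by simp
    note A = catalan_power_fps_joukowski[OF this]
    have "?c * (fps_X ^ (n * j) * ?A) oo ?J = ?c * (?J ^ (n * j) * (?A oo ?J))"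
      by (simp add: fps_compose_mult_distrib fps_compose_power[symmetric])
    also have "\<dots> = fps_rpow ?E (real n * k) * (?c * fps_X ^ j oo fps_X ^ n)"
      unfolding A J
      by (simp add: fps_compose_mult_distrib[OF Xn] fps_compose_power[OF Xn, symmetric]
          fps_X_fps_compose_startby0[OF Xn] power_mult)
    finally show "fps_const (gegenbauer_product k j (real n * \<theta>) (real n * \<phi>)) * (fps_X ^ (n * j) * ?A) oo ?J =
        fps_rpow ?E (real n * k) * (?c * fps_X ^ j oo fps_X ^ n)"
      by (simp only: ab)
  qed
  ultimately have RL: "(?R - ?L) oo ?J = fps_rpow ?E (real n * k) * (D oo fps_X ^ n)"
    unfolding D_def by (simp only: fps_compose_sub_distrib right_diff_distrib)
  \<comment> \<open>Vanishing up to index \<open>N\<close> in the variable \<open>w^n\<close> means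
    order at least \<open>n * (N + 1)\<close> in \<open>w\<close>, which exceeds
    \<open>N\<close>.\<close>
  have "D $ i = 0" if "i \<le> N" for i
    using sum_upto_gegenbauer_gf_nth[OF that, of k a b] that
    by (simp add: D_def fps_sum_nth if_distrib sum.delta cong: if_cong)
  then have "D = fps_X ^ Suc N * fps_shift (Suc N) D"
    by (intro fps_ext) (auto simp: fps_X_power_mult_nth simp del: power_Suc)
  then have "D oo fps_X ^ n = (fps_X ^ Suc N * fps_shift (Suc N) D) oo fps_X ^ n"
    by simp
  also have "\<dots> = fps_X ^ (n * Suc N) * (fps_shift (Suc N) D oo fps_X ^ n)"
    by (simp add: fps_compose_mult_distrib[OF Xn] fps_compose_power[OF Xn, symmetric]
          fps_X_fps_compose_startby0[OF Xn] power_mult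
        del: power_Suc mult_Suc_right)
  finally have "(?R - ?L) oo ?J = fps_X ^ (n * Suc N) *
      (fps_rpow ?E (real n * k) * (fps_shift (Suc N) D oo fps_X ^ n))"
    unfolding RL by (simp only: ac_simps)
  moreover have "N < n * Suc N"
    using n by (cases n) auto
  ultimately have "(?R - ?L) $ N = 0"
    by (rule fps_nth_eq_0_if_compose_joukowski)
  then show ?thesis by simp
qed

section \<open>Dirichlet integrals\<close>

text \<open>Rescaling by \<open>S\<close> reduces this to the unit interval. For
  \<open>S = 0\<close> both sides are \<open>0\<close>, because \<open>0 powr x = 0\<close> for
  every \<open>x\<close>.\<close>

lemma nn_integral_Beta_scaled:
  fixes a b S :: real
  assumes a: "a > 0" and b: "b > 0" and S: "S \<ge> 0"
  shows "(\<integral>\<^sup>+ y. ennreal (indicator {0..S} y * (y powr (a - 1) * (S - y) powr (b - 1))) \<partial>lborel) =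
    ennreal (Beta a b * S powr (a + b - 1))"
proof (cases "S = 0")
  case True
  have "(\<lambda>y. ennreal (indicator {0..S} y * (y powr (a - 1) * (S - y) powr (b - 1)))) = (\<lambda>_. 0)"
    using True by (auto simp: fun_eq_iff indicator_def)
  then show ?thesis using True by simp
next
  case False
  with S have S: "S > 0" by simp
  let ?f = "\<lambda>y. ennreal (indicator {0..S} y * (y powr (a - 1) * (S - y) powr (b - 1)))"
  have base: "(\<integral>\<^sup>+ y. ennreal (y powr (a - 1) * (1 - y) powr (b - 1) * indicator {0..1} y) \<partial>lborel) = ennreal (Beta a b)"
    using nn_integral_has_integral_lebesgue[OF _ has_integral_Beta_real[OF a b]] by (simp add: mult.commute)
  have "(\<integral>\<^sup>+ y. ?f y \<partial>lborel) = S * (\<integral>\<^sup>+ y. ?f (0 + S * y) \<partial>lborel)"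
    using S by (subst nn_integral_real_affine[where c = S and t = 0]) auto
  also have "(\<lambda>y. ?f (0 + S * y)) = (\<lambda>y. ennreal (S powr (a + b - 2)) *
      ennreal (y powr (a - 1) * (1 - y) powr (b - 1) * indicator {0..1} y))"
  proof
    fix y
    show "?f (0 + S * y) = ennreal (S powr (a + b - 2)) *
      ennreal (y powr (a - 1) * (1 - y) powr (b - 1) * indicator {0..1} y)"
    proof (cases "y \<in> {0..1}")
      case True
      have "S - S * y = S * (1 - y)" by (simp add: algebra_simps)
      moreover have "S powr (a - 1) * S powr (b - 1) = S powr (a + b - 2)"
        by (simp flip: powr_add)
      ultimately show ?thesis
        using True S by (simp add: powr_mult ac_simps mult_left_le flip: ennreal_mult')
    next
      case False
      then show ?thesis
        using S by (auto simp: indicator_def zero_le_mult_iff)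
    qed
  qed
  also have "S * (\<integral>\<^sup>+ y. ennreal (S powr (a + b - 2)) *
      ennreal (y powr (a - 1) * (1 - y) powr (b - 1) * indicator {0..1} y) \<partial>lborel) =
      ennreal S * (ennreal (S powr (a + b - 2)) * ennreal (Beta a b))"
    by (subst nn_integral_cmult) (simp_all add: base)
  also have "\<dots> = ennreal (Beta a b * (S * S powr (a + b - 2)))"
    using S by (simp flip: ennreal_mult') (simp add: ac_simps)
  also have "S * S powr (a + b - 2) = S powr (a + b - 1)"
    using S by (simp add: powr_mult_base)
  finally show ?thesis .
qed

text \<open>Integrating out the new coordinate over \<open>{0..1 - (\<Sum>s\<in>I. u s)}\<close> by
  the scaled Beta integral merges its parameter with \<open>a0\<close>, which is why
  \<open>a0\<close> stays arbitrary in the induction. With nonnegative integrals the iterated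
  integration raises no question of integrability.\<close>

lemma nn_integral_Dirichlet:
  fixes a :: "'i \<Rightarrow> real"
  assumes "finite I" "\<And>s. s \<in> I \<Longrightarrow> a s > 0" "a0 > 0"
  shows "(\<integral>\<^sup>+ u. ennreal ((if (\<forall>s\<in>I. u s \<ge> 0) \<and> (\<Sum>s\<in>I. u s) \<le> 1 then 1 else 0) *
      ((\<Prod>s\<in>I. u s powr (a s - 1)) * (1 - (\<Sum>s\<in>I. u s)) powr (a0 - 1))) \<partial>(\<Pi>\<^sub>M s\<in>I. lborel)) =
    ennreal (Gamma a0 * (\<Prod>s\<in>I. Gamma (a s)) / Gamma (a0 + (\<Sum>s\<in>I. a s)))"
  using assms
proof (induction I arbitrary: a0 rule: finite_induct)
  case empty
  interpret P: product_sigma_finite "\<lambda>_ :: 'i. lborel :: real measure" by standard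
  have "Gamma a0 \<noteq> 0"
    using Gamma_real_pos[of a0] empty by linarith
  then show ?case
    by (simp add: PiM_empty)
next
  case (insert i I)
  interpret product_sigma_finite "\<lambda>_ :: 'i. lborel :: real measure" by standard
  have ai: "a i > 0" using insert by auto
  let ?T = "\<lambda>u :: 'i \<Rightarrow> real. 1 - (\<Sum>s\<in>I. u s)"
  let ?f = "\<lambda>u. ennreal ((if (\<forall>s\<in>insert i I. u s \<ge> 0) \<and> (\<Sum>s\<in>insert i I. u s) \<le> 1 then 1 else 0) *
      ((\<Prod>s\<in>insert i I. u s powr (a s - 1)) * (1 - (\<Sum>s\<in>insert i I. u s)) powr (a0 - 1)))"
  let ?g = "\<lambda>u. ennreal ((if (\<forall>s\<in>I. u s \<ge> 0) \<and> (\<Sum>s\<in>I. u s) \<le> 1 then 1 else 0) *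
      ((\<Prod>s\<in>I. u s powr (a s - 1)) * (1 - (\<Sum>s\<in>I. u s)) powr (a i + a0 - 1)))"
  have [measurable]: "?f \<in> borel_measurable (\<Pi>\<^sub>M s\<in>insert i I. lborel)"
  proof -
    have [measurable]: "(\<lambda>u. \<Sum>s\<in>insert i I. u s) \<in> borel_measurable (\<Pi>\<^sub>M s\<in>insert i I. (lborel :: real measure))"
      by (intro borel_measurable_sum) measurable
    have [measurable]: "(\<lambda>u. \<Prod>s\<in>insert i I. u s powr (a s - 1)) \<in> borel_measurable (\<Pi>\<^sub>M s\<in>insert i I. (lborel :: real measure))"
      by (intro borel_measurable_prod) measurable
    have [measurable]: "Measurable.pred (\<Pi>\<^sub>M s\<in>insert i I. (lborel :: real measure)) (\<lambda>u. \<forall>s\<in>insert i I. u s \<ge> 0)"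
      using insert(1) by (intro pred_intros_finite) (simp, measurable)
    show ?thesis by measurable
  qed
  have inner: "(\<integral>\<^sup>+ y. ?f (u(i := y)) \<partial>lborel) = ennreal (Beta (a i) a0) * ?g u" for u
  proof (cases "(\<forall>s\<in>I. u s \<ge> 0) \<and> (\<Sum>s\<in>I. u s) \<le> 1")
    case True
    define P where "P = (\<Prod>s\<in>I. u s powr (a s - 1))"
    have P: "P \<ge> 0" unfolding P_def by (intro prod_nonneg) auto
    have "?f (u(i := y)) = ennreal P * ennreal (indicator {0..?T u} y * (y powr (a i - 1) * (?T u - y) powr (a0 - 1)))"
      for y
    proof -
      have 1: "(\<Sum>s\<in>insert i I. (u(i := y)) s) = y + (\<Sum>s\<in>I. u s)"
        using insert by (simp cong: sum.cong_simp) (intro sum.cong; auto)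
      have 2: "(\<Prod>s\<in>insert i I. (u(i := y)) s powr (a s - 1)) = y powr (a i - 1) * P"
        unfolding P_def using insert by simp (intro disjI2 prod.cong; auto)
      have 3: "(\<forall>s\<in>insert i I. (u(i := y)) s \<ge> 0) \<longleftrightarrow> y \<ge> 0"
        using True insert by auto
      show ?thesis
        unfolding 1 2 3 using P
        by (auto simp: indicator_def algebra_simps simp flip: ennreal_mult')
    qed
    then have "(\<integral>\<^sup>+ y. ?f (u(i := y)) \<partial>lborel) = ennreal P * ennreal (Beta (a i) a0 * ?T u powr (a i + a0 - 1))"
      using True insert ai by (simp add: nn_integral_cmult nn_integral_Beta_scaled)
    also have "\<dots> = ennreal (Beta (a i) a0) * ?g u"
    proof -
      have "Beta (a i) a0 \<ge> 0"
        using ai insert.prems(2) by (auto simp: Beta_def intro!: divide_nonneg_nonneg mult_nonneg_nonneg Gamma_real_nonneg)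
      then show ?thesis
        using True P by (simp add: P_def[symmetric] ac_simps flip: ennreal_mult')
    qed
    finally show ?thesis .
  next
    case False
    have "\<not> ((\<forall>s\<in>insert i I. (u(i := y)) s \<ge> 0) \<and> (\<Sum>s\<in>insert i I. (u(i := y)) s) \<le> 1)" for y
    proof
      assume *: "(\<forall>s\<in>insert i I. (u(i := y)) s \<ge> 0) \<and> (\<Sum>s\<in>insert i I. (u(i := y)) s) \<le> 1"
      have eq: "(u(i := y)) s = u s" if "s \<in> I" for s using that insert by auto
      have "(\<Sum>s\<in>insert i I. (u(i := y)) s) = y + (\<Sum>s\<in>I. u s)"
        using insert by (simp cong: sum.cong_simp) (intro sum.cong; auto)
      with * eq False show False by force
    qed
    then have "(\<integral>\<^sup>+ y. ?f (u(i := y)) \<partial>lborel) = (\<integral>\<^sup>+ y. 0 \<partial>(lborel :: real measure))"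
      by (intro nn_integral_cong) (simp only: if_False mult_zero_left ennreal_0)
    also have "\<dots> = ennreal (Beta (a i) a0) * ?g u"
      using False by (simp only: if_False mult_zero_left ennreal_0) simp
    finally show ?thesis .
  qed
  have "(\<integral>\<^sup>+ u. ?f u \<partial>(\<Pi>\<^sub>M s\<in>insert i I. lborel)) =
      (\<integral>\<^sup>+ u. ennreal (Beta (a i) a0) * ?g u \<partial>(\<Pi>\<^sub>M s\<in>I. lborel))"
    using insert(1,2) by (subst product_nn_integral_insert) (simp_all only: inner, auto)
  also have "\<dots> = ennreal (Beta (a i) a0) * (\<integral>\<^sup>+ u. ?g u \<partial>(\<Pi>\<^sub>M s\<in>I. lborel))"
    using insert(1) by (intro nn_integral_cmult) measurable
  also have "\<dots> = ennreal (Beta (a i) a0) *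
      ennreal (Gamma (a i + a0) * (\<Prod>s\<in>I. Gamma (a s)) / Gamma ((a i + a0) + (\<Sum>s\<in>I. a s)))"
    using insert.IH[of "a i + a0"] insert.prems ai by simp
  also have "\<dots> = ennreal (Beta (a i) a0 *
      (Gamma (a i + a0) * (\<Prod>s\<in>I. Gamma (a s)) / Gamma ((a i + a0) + (\<Sum>s\<in>I. a s))))"
    using ai insert.prems(2) by (intro ennreal_mult'[symmetric])
      (auto simp: Beta_def intro!: divide_nonneg_nonneg mult_nonneg_nonneg Gamma_real_nonneg)
  also have "Beta (a i) a0 *
      (Gamma (a i + a0) * (\<Prod>s\<in>I. Gamma (a s)) / Gamma ((a i + a0) + (\<Sum>s\<in>I. a s))) =
    Gamma a0 * (\<Prod>s\<in>insert i I. Gamma (a s)) / Gamma (a0 + (\<Sum>s\<in>insert i I. a s))"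
  proof -
    have "Gamma (a i + a0) > 0" using ai insert.prems(2) by (intro Gamma_real_pos add_pos_pos)
    then show ?thesis using insert(1,2) by (simp add: Beta_def add.commute add.left_commute)
  qed
  finally show ?case .
qed

text \<open>Treats \<open>u_0\<close> as coordinate \<open>0\<close>, so that sums and products over
  all barycentric coordinates run over \<open>{..<n}\<close>, like those over the \<open>n\<close>
  rotated angles.\<close>

definition simplex_coord :: "nat \<Rightarrow> (nat \<Rightarrow> real) \<Rightarrow> nat \<Rightarrow> real" where
  "simplex_coord n u s = (if s = 0 then simplex_u0 n u else u s)"

lemma lessThan_split_0: "n > 0 \<Longrightarrow> {..<n} = insert 0 {1..<n :: nat}"
  by auto

lemma prod_simplex_coord:
  "n > 0 \<Longrightarrow> (\<Prod>s<n. f s (simplex_coord n u s)) = f 0 (simplex_u0 n u) * (\<Prod>s=1..<n. f s (u s))"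
  for f :: "nat \<Rightarrow> real \<Rightarrow> real"
  by (simp add: lessThan_split_0 simplex_coord_def)

lemma sum_simplex_coord:
  "n > 0 \<Longrightarrow> (\<Sum>s<n. f s (simplex_coord n u s)) = f 0 (simplex_u0 n u) + (\<Sum>s=1..<n. f s (u s))"
  for f :: "nat \<Rightarrow> real \<Rightarrow> real"
  by (simp add: lessThan_split_0 simplex_coord_def)

lemma simplex_coord_nonneg: "u \<in> standard_simplex n \<Longrightarrow> s < n \<Longrightarrow> simplex_coord n u s \<ge> 0"
  by (auto simp: simplex_coord_def standard_simplex_def)

lemma sum_simplex_coord_eq_1: "n > 0 \<Longrightarrow> (\<Sum>s<n. simplex_coord n u s) = 1"
  by (simp add: sum_simplex_coord[of n "\<lambda>_ x. x"]) (simp add: simplex_u0_def)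

lemma simplex_coord_le_1:
  assumes "u \<in> standard_simplex n" "s < n"
  shows "simplex_coord n u s \<le> 1"
proof -
  have "simplex_coord n u s \<le> (\<Sum>s<n. simplex_coord n u s)"
    using assms by (intro member_le_sum) (auto intro: simplex_coord_nonneg)
  then show ?thesis using assms sum_simplex_coord_eq_1[of n u] by simp
qed

lemma simplex_coord_measurable [measurable]:
  "s < n \<Longrightarrow> (\<lambda>u. simplex_coord n u s) \<in> borel_measurable (\<Pi>\<^sub>M s\<in>{1..<n}. lborel)"
  unfolding simplex_coord_def simplex_u0_def by (cases "s = 0") auto

lemma standard_simplex_sets [measurable]: "standard_simplex n \<in> sets (\<Pi>\<^sub>M s\<in>{1..<n}. lborel)"
proof -
  have "standard_simplex n = {u \<in> space (\<Pi>\<^sub>M s\<in>{1..<n}. lborel). simplex_u0 n u \<ge> 0 \<and> (\<forall>s\<in>{1..<n}. u s \<ge> 0)}"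
    by (auto simp: standard_simplex_def space_PiM)
  also have "\<dots> \<in> sets (\<Pi>\<^sub>M s\<in>{1..<n}. lborel)"
    unfolding simplex_u0_def by measurable
  finally show ?thesis .
qed

lemma has_bochner_integral_Dirichlet:
  assumes n: "n > 0" and a: "\<And>s. s < n \<Longrightarrow> a s > 0"
  shows "has_bochner_integral (\<Pi>\<^sub>M s\<in>{1..<n}. lborel)
    (\<lambda>u. indicator (standard_simplex n) u * (\<Prod>s<n. simplex_coord n u s powr (a s - 1)))
    ((\<Prod>s<n. Gamma (a s)) / Gamma (\<Sum>s<n. a s))"
proof (rule has_bochner_integral_nn_integral)
  let ?M = "\<Pi>\<^sub>M s\<in>{1..<n}. lborel :: real measure"
  show "(\<lambda>u. indicator (standard_simplex n) u * (\<Prod>s<n. simplex_coord n u s powr (a s - 1)))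
    \<in> borel_measurable ?M" by measurable
  show "AE u in ?M. 0 \<le> indicator (standard_simplex n) u * (\<Prod>s<n. simplex_coord n u s powr (a s - 1))"
    by (intro always_eventually allI mult_nonneg_nonneg prod_nonneg) auto
  show "0 \<le> (\<Prod>s<n. Gamma (a s)) / Gamma (\<Sum>s<n. a s)"
    using a n by (intro divide_nonneg_nonneg prod_nonneg Gamma_real_nonneg sum_pos) auto
  have "(\<integral>\<^sup>+ u. ennreal (indicator (standard_simplex n) u * (\<Prod>s<n. simplex_coord n u s powr (a s - 1))) \<partial>?M) =
    (\<integral>\<^sup>+ u. ennreal ((if (\<forall>s\<in>{1..<n}. u s \<ge> 0) \<and> (\<Sum>s\<in>{1..<n}. u s) \<le> 1 then 1 else 0) *
      ((\<Prod>s\<in>{1..<n}. u s powr (a s - 1)) * (1 - (\<Sum>s\<in>{1..<n}. u s)) powr (a 0 - 1))) \<partial>?M)"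
  proof (intro nn_integral_cong)
    fix u assume "u \<in> space ?M"
    then have "u \<in> standard_simplex n \<longleftrightarrow> (\<forall>s\<in>{1..<n}. u s \<ge> 0) \<and> (\<Sum>s\<in>{1..<n}. u s) \<le> 1"
      by (auto simp: standard_simplex_def space_PiM simplex_u0_def)
    then show "ennreal (indicator (standard_simplex n) u * (\<Prod>s<n. simplex_coord n u s powr (a s - 1))) =
      ennreal ((if (\<forall>s\<in>{1..<n}. u s \<ge> 0) \<and> (\<Sum>s\<in>{1..<n}. u s) \<le> 1 then 1 else 0) *
      ((\<Prod>s\<in>{1..<n}. u s powr (a s - 1)) * (1 - (\<Sum>s\<in>{1..<n}. u s)) powr (a 0 - 1)))"
      using prod_simplex_coord[OF n, of "\<lambda>s x. x powr (a s - 1)" u]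
      by (simp add: indicator_def mult.commute simplex_u0_def)
  qed
  also have "\<dots> = ennreal (Gamma (a 0) * (\<Prod>s\<in>{1..<n}. Gamma (a s)) / Gamma (a 0 + (\<Sum>s\<in>{1..<n}. a s)))"
    using a n by (intro nn_integral_Dirichlet) auto
  also have "\<dots> = ennreal ((\<Prod>s<n. Gamma (a s)) / Gamma (\<Sum>s<n. a s))"
    using n by (simp add: lessThan_split_0)
  finally show "(\<integral>\<^sup>+ u. ennreal (indicator (standard_simplex n) u * (\<Prod>s<n. simplex_coord n u s powr (a s - 1))) \<partial>?M) =
    ennreal ((\<Prod>s<n. Gamma (a s)) / Gamma (\<Sum>s<n. a s))" .
qed

lemma fps_exp_sum: "finite A \<Longrightarrow> fps_exp (\<Sum>s\<in>A. f s) = (\<Prod>s\<in>A. fps_exp (f s))" for f :: "'i \<Rightarrow> real"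
  by (induction A rule: finite_induct) (auto simp: fps_exp_add_mult)

text \<open>Both the powers of a linear form and the coefficients of the product of binomial series are
  sums over the same multi-indices, and the Dirichlet integral matches them term by term.\<close>
lemma has_bochner_integral_Dirichlet_power:
  assumes n: "n > 0" and a: "a > 0"
  shows "has_bochner_integral (\<Pi>\<^sub>M s\<in>{1..<n}. lborel)
    (\<lambda>u. indicator (standard_simplex n) u * ((\<Sum>s<n. c s * simplex_coord n u s) ^ i / fact i *
      (\<Prod>s<n. simplex_coord n u s powr (a - 1))))
    (Gamma a ^ n / Gamma (real n * a + real i) *
      (\<Prod>s<n. fps_rpow (1 - fps_const (c s) * fps_X) (- a)) $ i)"
proof -
  let ?M = "\<Pi>\<^sub>M s\<in>{1..<n}. lborel :: real measure"
  let ?U = "simplex_coord n"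
  \<comment> \<open>Multi-indices of total degree \<open>i\<close> are encoded as multisets;
    \<open>count X s\<close> is the exponent of coordinate \<open>s\<close>.\<close>
  let ?X = "multisets_of_size {..<n} i"
  define C where "C = (\<lambda>X. \<Prod>s<n. c s ^ count X s / fact (count X s))"
  define F where "F = (\<lambda>X u. C X * (indicator (standard_simplex n) u * (\<Prod>s<n. ?U u s powr (a + real (count X s) - 1))))"
  have X: "(\<Sum>s<n. count X s) = i" if "X \<in> ?X" for X
  proof -
    have "size X = (\<Sum>s<n. count X s)"
      unfolding size_multiset_overloaded_eq using that
      by (intro sum.mono_neutral_left) (auto simp: multisets_of_size_def not_in_iff)
    with that show ?thesis by (simp add: multisets_of_size_def)
  qed
  have "has_bochner_integral ?M (\<lambda>u. \<Sum>X\<in>?X. F X u)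
    (\<Sum>X\<in>?X. C X * ((\<Prod>s<n. Gamma (a + real (count X s))) / Gamma (\<Sum>s<n. a + real (count X s))))"
    unfolding F_def using n a
    by (intro has_bochner_integral_sum has_bochner_integral_mult_right has_bochner_integral_Dirichlet)
      (auto intro: add_pos_nonneg)
  also have "(\<lambda>u. \<Sum>X\<in>?X. F X u) = (\<lambda>u. indicator (standard_simplex n) u *
      ((\<Sum>s<n. c s * ?U u s) ^ i / fact i * (\<Prod>s<n. ?U u s powr (a - 1))))"
  proof
    fix u
    show "(\<Sum>X\<in>?X. F X u) = indicator (standard_simplex n) u *
      ((\<Sum>s<n. c s * ?U u s) ^ i / fact i * (\<Prod>s<n. ?U u s powr (a - 1)))"
    proof (cases "u \<in> standard_simplex n")
      case True
      \<comment> \<open>The multinomial theorem appears as a coefficient of the exponential series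
        of a sum, which is a product of exponential series.\<close>
      have "(\<Sum>s<n. c s * ?U u s) ^ i / fact i = fps_exp (\<Sum>s<n. c s * ?U u s) $ i"
        by simp
      also have "\<dots> = (\<Sum>X\<in>?X. \<Prod>s<n. (c s * ?U u s) ^ count X s / fact (count X s))"
        unfolding fps_exp_sum[OF finite_lessThan] by (subst fps_prod_nth') auto
      finally have "(\<Sum>s<n. c s * ?U u s) ^ i / fact i * (\<Prod>s<n. ?U u s powr (a - 1)) =
          (\<Sum>X\<in>?X. (\<Prod>s<n. (c s * ?U u s) ^ count X s / fact (count X s) * ?U u s powr (a - 1)))"
        by (simp only: sum_distrib_right prod.distrib)
      also have "\<dots> = (\<Sum>X\<in>?X. F X u)"
      proof (intro sum.cong refl)
        fix X
        have "(c s * ?U u s) ^ count X s / fact (count X s) * ?U u s powr (a - 1) =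
          c s ^ count X s / fact (count X s) * ?U u s powr (a + real (count X s) - 1)" if "s < n" for s
        \<comment> \<open>At a zero coordinate both sides vanish, since
          \<open>0 powr x = 0\<close>.\<close>
        proof (cases "?U u s = 0")
          case False
          with simplex_coord_nonneg[OF True that] have "?U u s > 0" by simp
          then have "?U u s powr (a + real (count X s) - 1) = ?U u s ^ count X s * ?U u s powr (a - 1)"
            by (simp add: powr_realpow[symmetric] flip: powr_add) (simp add: algebra_simps)
          then show ?thesis by (simp add: power_mult_distrib)
        qed auto
        then show "(\<Prod>s<n. (c s * ?U u s) ^ count X s / fact (count X s) * ?U u s powr (a - 1)) = F X u"
          using True by (simp add: F_def C_def flip: prod.distrib)
      qed
      finally show ?thesis using True by simp
    qed (simp add: F_def)
  qed
  also have "(\<Sum>X\<in>?X. C X * ((\<Prod>s<n. Gamma (a + real (count X s))) / Gamma (\<Sum>s<n. a + real (count X s)))) =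
    (\<Sum>X\<in>?X. Gamma a ^ n / Gamma (real n * a + real i) *
      (\<Prod>s<n. pochhammer a (count X s) / fact (count X s) * c s ^ count X s))"
  proof (intro sum.cong refl)
    fix X assume "X \<in> ?X"
    from X[OF this] have "(\<Sum>s<n. a + real (count X s)) = real n * a + real i"
      by (simp add: sum.distrib flip: of_nat_sum)
    moreover have "Gamma (a + real m) = Gamma a * pochhammer a m" for m
    proof -
      have "Gamma a > 0" using a by (rule Gamma_real_pos)
      moreover have "pochhammer a m = Gamma (a + real m) / Gamma a"
        using a by (intro pochhammer_Gamma) (auto elim!: nonpos_Ints_cases)
      ultimately show ?thesis by simp
    qed
    ultimately show "C X * ((\<Prod>s<n. Gamma (a + real (count X s))) / Gamma (\<Sum>s<n. a + real (count X s))) =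
       Gamma a ^ n / Gamma (real n * a + real i) *
      (\<Prod>s<n. pochhammer a (count X s) / fact (count X s) * c s ^ count X s)"
      by (simp add: C_def prod.distrib prod_dividef ac_simps)
  qed
  also have "\<dots> = Gamma a ^ n / Gamma (real n * a + real i) *
      (\<Prod>s<n. fps_rpow (1 - fps_const (c s) * fps_X) (- a)) $ i"
    by (subst fps_prod_nth') (simp_all add: fps_rpow_linear_nth sum_distrib_left)
  finally show ?thesis .
qed

section \<open>The Bessel series\<close>

lemma summable_on_times:
  fixes f g :: "nat \<Rightarrow> real"
  assumes "summable f" "summable g" "\<And>i. f i \<ge> 0" "\<And>i. g i \<ge> 0"
  shows "(\<lambda>p. f (fst p) * g (snd p)) summable_on UNIV"
proof -
  have "(g has_sum suminf g) UNIV"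
    using assms by (intro norm_summable_imp_has_sum) (auto simp: sums_iff)
  then have "((\<lambda>j. f i * g j) has_sum f i * suminf g) UNIV" for i
    by (rule has_sum_cmult_right)
  moreover have "(\<lambda>i. f i * suminf g) summable_on UNIV"
    using assms by (intro summable_on_cmult_left norm_summable_imp_summable_on) auto
  ultimately have "(\<lambda>p. f (fst p) * g (snd p)) summable_on Sigma UNIV (\<lambda>_. UNIV)"
    using assms by (intro summable_on_SigmaI) auto
  then show ?thesis by simp
qed

lemma summable_on_norm_le:
  fixes f g :: "'a \<Rightarrow> real"
  assumes "g summable_on A" "\<And>x. x \<in> A \<Longrightarrow> \<bar>f x\<bar> \<le> g x"
  shows "f summable_on A"
proof (rule Infinite_Sum.abs_summable_summable, rule Infinite_Sum.abs_summable_on_comparison_test')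
  show "g summable_on A" by fact
  show "norm (f x) \<le> g x" if "x \<in> A" for x
    using assms(2)[OF that] by simp
qed

lemma summable_on_pairs_sums:
  fixes f :: "nat \<times> nat \<Rightarrow> real"
  assumes "f summable_on UNIV"
  shows "(\<lambda>j. f (i, j)) summable_on UNIV"
    and "(\<lambda>i. \<Sum>j. f (i, j)) sums infsum f UNIV"
proof -
  have S: "f summable_on Sigma UNIV (\<lambda>_. UNIV)" using assms by simp
  have row: "(\<lambda>j. f (i, j)) summable_on UNIV" for i
    using summable_on_SigmaD1[of "\<lambda>i j. f (i, j)" UNIV "\<lambda>_. UNIV" i] S by simp
  then show "(\<lambda>j. f (i, j)) summable_on UNIV" .
  have eq: "(\<Sum>\<^sub>\<infinity>j. f (i, j)) = (\<Sum>j. f (i, j))" for i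
    using row[of i] by (metis has_sum_imp_sums has_sum_infsum sums_unique)
  have "(\<lambda>i. \<Sum>\<^sub>\<infinity>j. f (i, j)) summable_on UNIV"
    using summable_on_Sigma_banach[of "\<lambda>i j. f (i, j)" UNIV "\<lambda>_. UNIV"] S by simp
  moreover have "infsum (\<lambda>i. \<Sum>\<^sub>\<infinity>j. f (i, j)) UNIV = infsum f UNIV"
    using infsum_Sigma_banach[OF S] by simp
  ultimately have "((\<lambda>i. \<Sum>\<^sub>\<infinity>j. f (i, j)) has_sum infsum f UNIV) UNIV"
    by (metis has_sum_infsum)
  then show "(\<lambda>i. \<Sum>j. f (i, j)) sums infsum f UNIV"
    unfolding eq by (rule has_sum_imp_sums)
qed

text \<open>Reindexing by the graph of \<open>g\<close> turns the unordered sum into a sum over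
  fibres. It serves to sort double series by their degree in \<open>z\<close>.\<close>

lemma infsum_group:
  fixes f :: "'a \<Rightarrow> real" and g :: "'a \<Rightarrow> 'b"
  assumes f: "f summable_on UNIV" and fin: "\<And>N. finite {p. g p = N}"
  shows "infsum f UNIV = (\<Sum>\<^sub>\<infinity>N. \<Sum>p | g p = N. f p)"
proof -
  have bij: "bij_betw snd (Sigma UNIV (\<lambda>N. {p. g p = N})) (UNIV :: 'a set)"
    by (rule bij_betwI[where g = "\<lambda>p. (g p, p)"]) auto
  have "(\<lambda>x. f (snd x)) summable_on Sigma UNIV (\<lambda>N. {p. g p = N})"
    using summable_on_reindex_bij_betw[OF bij, of f] f by simp
  from infsum_Sigma_banach[OF this] infsum_reindex_bij_betw[OF bij, of f] fin
  show ?thesis by simp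
qed

lemma fact_le_pochhammer:
  fixes x :: real
  assumes "x \<ge> 1"
  shows "fact m \<le> pochhammer x m"
proof (induction m)
  case (Suc m)
  have "fact m * (real m + 1) \<le> pochhammer x m * (x + real m)"
    using Suc assms by (intro mult_mono) (auto intro: order_trans[OF fact_ge_zero])
  then show ?case by (simp add: pochhammer_Suc algebra_simps)
qed simp

lemma min_1_le_pochhammer:
  fixes x :: real
  assumes "x > 0"
  shows "min 1 x \<le> pochhammer x m"
proof (cases m)
  case (Suc i)
  have "1 \<le> pochhammer (x + 1) i"
    using fact_le_pochhammer[of "x + 1" i] fact_ge_1[of i, where ?'a = real] assms by linarith
  then have "x * 1 \<le> pochhammer x m"
    using assms unfolding Suc pochhammer_rec by (intro mult_left_mono) auto
  then show ?thesis by simp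
qed simp

lemma Gamma_ge_fact:
  fixes x :: real
  assumes "x \<ge> 1" "j \<le> m"
  shows "fact j * Gamma x \<le> Gamma (x + real m)"
proof -
  have "Gamma (x + real m) = pochhammer x m * Gamma x"
  proof -
    have "pochhammer x m = Gamma (x + real m) / Gamma x"
      using assms(1) by (intro pochhammer_Gamma) (auto elim!: nonpos_Ints_cases)
    moreover have "Gamma x \<noteq> 0"
      using assms(1) Gamma_real_pos[of x] by linarith
    ultimately show ?thesis by simp
  qed
  moreover have "fact j \<le> (fact m :: real)" "fact m \<le> pochhammer x m"
    using assms by (auto intro: fact_mono fact_le_pochhammer)
  moreover have "Gamma x > 0" using assms(1) by (intro Gamma_real_pos) auto
  ultimately show ?thesis by simp
qed

lemma gegenbauer_at_1_le:
  assumes "k > 0"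
  shows "gegenbauer k j 1 \<le> (2 * k + 1) ^ j"
proof -
  have "pochhammer (2 * k) j \<le> (2 * k + 1) ^ j * fact j"
  proof (induction j)
    case (Suc j)
    have "pochhammer (2 * k) j * (2 * k + real j) \<le> ((2 * k + 1) ^ j * fact j) * ((2 * k + 1) * (real j + 1))"
      using Suc assms by (intro mult_mono) (auto simp: algebra_simps)
    then show ?case by (simp add: pochhammer_Suc algebra_simps)
  qed simp
  then show ?thesis by (simp add: gegenbauer_at_1 field_simps)
qed

text \<open>Expanding the Bessel functions and cancelling \<open>2 / z\<close> to the power
  \<open>n * k\<close> leaves natural exponents only, so the terms make sense at
  \<open>z = 0\<close> as well.\<close>

definition bessel_term :: "nat \<Rightarrow> real \<Rightarrow> real \<Rightarrow> real \<Rightarrow> real \<Rightarrow> nat \<times> nat \<Rightarrow> real" where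
  "bessel_term n k \<phi> \<theta> z = (\<lambda>(j, l). (z / 2) ^ (n * j + 2 * l) * ((real j + k) *
     (gegenbauer k j (cos (real n * \<phi>)) * gegenbauer k j (cos (real n * \<theta>)) / gegenbauer k j 1)
     / (fact l * Gamma (real n * real j + real n * k + real l + 1))))"

text \<open>Collects bounds uniform in both angles: \<open>j + k \<le> (1 + k) * 2^j\<close>,
  \<open>gegenbauer k j 1 \<le> (2k + 1)^j\<close> and
  \<open>Gamma (n j + n k + l + 1) \<ge> fact j * Gamma (n k + 1)\<close>. The result is a product
  of terms of two exponential series.\<close>

definition bessel_majorant :: "nat \<Rightarrow> real \<Rightarrow> real \<Rightarrow> nat \<times> nat \<Rightarrow> real" where
  "bessel_majorant n k z p = ((1 + k) / Gamma (real n * k + 1) *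
     (((2 * (2 * k + 1)) * (z / 2) ^ n) ^ fst p / fact (fst p))) * (((z / 2)\<^sup>2) ^ snd p / fact (snd p))"

lemma summable_pow_fact: "summable (\<lambda>j. x ^ j / fact j)" for x :: real
  using summable_exp_generic[of x] by (simp add: field_simps)

lemma summable_bessel_majorant:
  assumes "k > 0" "z \<ge> 0"
  shows "bessel_majorant n k z summable_on UNIV"
proof -
  have G: "Gamma (real n * k + 1) > 0"
    using assms by (intro Gamma_real_pos add_nonneg_pos) auto
  show ?thesis
    unfolding bessel_majorant_def using assms G summable_pow_fact
    by (intro summable_on_times[of "\<lambda>j. (1 + k) / Gamma (real n * k + 1) *
     (((2 * (2 * k + 1)) * (z / 2) ^ n) ^ j / fact j)" "\<lambda>l. ((z / 2)\<^sup>2) ^ l / fact l"] summable_mult) auto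
qed

lemma abs_bessel_term_le:
  assumes k: "k > 0" and z: "z \<ge> 0" and n: "n > 0"
  shows "\<bar>bessel_term n k \<phi> \<theta> z p\<bar> \<le> bessel_majorant n k z p"
proof -
  obtain j l where p: "p = (j, l)" by force
  define x where "x = real n * k + 1"
  have x: "x \<ge> 1" using k by (simp add: x_def)
  have Gx: "Gamma x > 0" using x by (intro Gamma_real_pos) auto
  have G: "fact j * Gamma x \<le> Gamma (real n * real j + real n * k + real l + 1)"
  proof -
    have "j \<le> n * j + l" using n by (cases n) auto
    from Gamma_ge_fact[OF x this] show ?thesis
      by (simp add: x_def algebra_simps)
  qed
  have Y: "Gamma (real n * real j + real n * k + real l + 1) > 0"
    by (rule less_le_trans[OF _ G]) (use Gx in simp)
  have C1: "gegenbauer k j 1 > 0" using k by (rule gegenbauer_at_1_pos)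
  have "\<bar>gegenbauer k j (cos (real n * \<phi>))\<bar> * \<bar>gegenbauer k j (cos (real n * \<theta>))\<bar>
      \<le> gegenbauer k j 1 * gegenbauer k j 1"
    using C1 by (intro mult_mono abs_gegenbauer_cos_le k) auto
  then have C: "\<bar>gegenbauer k j (cos (real n * \<phi>)) * gegenbauer k j (cos (real n * \<theta>)) / gegenbauer k j 1\<bar>
      \<le> (2 * k + 1) ^ j"
    using C1 by (intro order_trans[OF _ gegenbauer_at_1_le[OF k, of j]]) (simp add: abs_mult divide_le_eq)
  have J: "real j + k \<le> (1 + k) * 2 ^ j"
  proof -
    have "real j \<le> 2 ^ j" by (rule less_imp_le[OF of_nat_less_two_power])
    moreover have "k * 1 \<le> k * 2 ^ j" using k by (intro mult_left_mono) auto
    ultimately show ?thesis unfolding distrib_right by linarith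
  qed
  have "\<bar>bessel_term n k \<phi> \<theta> z p\<bar> = (z / 2) ^ (n * j + 2 * l) * ((real j + k) *
     \<bar>gegenbauer k j (cos (real n * \<phi>)) * gegenbauer k j (cos (real n * \<theta>)) / gegenbauer k j 1\<bar>
     / (fact l * Gamma (real n * real j + real n * k + real l + 1)))"
    using k z Y by (simp add: bessel_term_def p abs_mult)
  also have "\<dots> \<le> (z / 2) ^ (n * j + 2 * l) * (((1 + k) * 2 ^ j) * (2 * k + 1) ^ j / (fact l * (fact j * Gamma x)))"
    using k z G Gx J C by (intro mult_left_mono frac_le mult_mono) auto
  also have "\<dots> = bessel_majorant n k z p"
    unfolding bessel_majorant_def p x_def power_add power_mult power_mult_distrib
    by (simp add: mult_ac)
  finally show ?thesis .
qed

lemma summable_bessel_term: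
  assumes "k > 0" "z \<ge> 0" "n > 0"
  shows "bessel_term n k \<phi> \<theta> z summable_on UNIV"
proof (rule summable_on_norm_le)
  show "bessel_majorant n k z summable_on UNIV"
    by (rule summable_bessel_majorant) fact+
  show "\<bar>bessel_term n k \<phi> \<theta> z p\<bar> \<le> bessel_majorant n k z p" for p
    by (rule abs_bessel_term_le) fact+
qed

lemma dihedral_bessel_series_eq:
  assumes k: "k > 0" and n: "n > 0" and z: "\<rho> > 0" "r > 0"
  shows "dihedral_bessel_series c n k \<rho> \<phi> r \<theta> =
    c / Beta (k + 1/2) (1/2) * infsum (bessel_term n k \<phi> \<theta> (\<rho> * r)) UNIV"
proof -
  define z where "z = \<rho> * r"
  have z0: "z > 0" using z by (simp add: z_def)
  let ?G = "\<lambda>j. gegenbauer k j (cos (real n * \<phi>)) * gegenbauer k j (cos (real n * \<theta>)) / gegenbauer k j 1"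
  let ?t = "bessel_term n k \<phi> \<theta> z"
  have S: "?t summable_on UNIV" using k n z0 by (intro summable_bessel_term) auto
  have "bessel_I (real n * real j + real n * k) z * (real j + k) * ?G j =
      (z / 2) powr (real n * k) * (\<Sum>l. ?t (j, l))" for j
  proof -
    have s: "summable (\<lambda>l. ?t (j, l))"
      using summable_on_pairs_sums(1)[OF S] by (rule summable_on_imp_summable)
    let ?b = "\<lambda>m. 1 / (fact m * Gamma (real n * real j + real n * k + real m + 1)) *
        (z / 2) powr (2 * real m + (real n * real j + real n * k))"
    have pw: "(z / 2) powr (2 * real m + (real n * real j + real n * k)) =
        (z / 2) powr (real n * k) * (z / 2) ^ (n * j + 2 * m)" for m
      using z0 by (simp add: powr_realpow[symmetric] flip: powr_add) (simp add: algebra_simps)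
    show ?thesis
    \<comment> \<open>Convergence of the series defining \<open>bessel_I\<close> is read off from a
      row of the double series by dividing out this factor; where the factor is \<open>0\<close>, so
      are both sides.\<close>
    proof (cases "(real j + k) * ?G j = 0")
      case True
      then show ?thesis by (auto simp: bessel_term_def)
    next
      case False
      have "?t (j, l) = ((real j + k) * ?G j / (z / 2) powr (real n * k)) * ?b l" for l
        using z0 unfolding pw by (simp add: bessel_term_def)
      then have eq: "(\<lambda>l. ?t (j, l)) = (\<lambda>l. ((real j + k) * ?G j / (z / 2) powr (real n * k)) * ?b l)"
        by (intro ext)
      have "summable ?b"
        using s False z0 unfolding eq by (subst (asm) summable_cmult_iff) auto
      then have "(\<Sum>l. ?t (j, l)) = ((real j + k) * ?G j / (z / 2) powr (real n * k)) * bessel_I (real n * real j + real n * k) z"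
        unfolding eq bessel_I_def by (rule suminf_mult)
      then show ?thesis using z0 by simp
    qed
  qed
  then have "(\<Sum>j. bessel_I (real n * real j + real n * k) z * (real j + k) * ?G j) =
      (\<Sum>j. (z / 2) powr (real n * k) * (\<Sum>l. ?t (j, l)))"
    by simp
  also have "\<dots> = (z / 2) powr (real n * k) * infsum ?t UNIV"
    using summable_on_pairs_sums(2)[OF S] by (simp add: sums_iff suminf_mult)
  finally have S: "(\<Sum>j. bessel_I (real n * real j + real n * k) z * (real j + k) * ?G j) =
    (z / 2) powr (real n * k) * infsum ?t UNIV" .
  have P: "(2 / (r * \<rho>)) powr (real n * k) * (z / 2) powr (real n * k) = 1"
    using z by (simp add: z_def mult.commute flip: powr_mult)
  have "dihedral_bessel_series c n k \<rho> \<phi> r \<theta> = c / Beta (k + 1/2) (1/2) * (2 / (r * \<rho>)) powr (real n * k) *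
      ((z / 2) powr (real n * k) * infsum ?t UNIV)"
    unfolding dihedral_bessel_series_def z_def[symmetric] S ..
  also have "\<dots> = c / Beta (k + 1/2) (1/2) *
      ((2 / (r * \<rho>)) powr (real n * k) * (z / 2) powr (real n * k)) * infsum ?t UNIV"
    by (simp only: ac_simps)
  finally show ?thesis
    unfolding P by (simp add: z_def)
qed

lemma infsum_bessel_term_0:
  assumes "n > 0"
  shows "infsum (bessel_term n k \<phi> \<theta> 0) UNIV = k / Gamma (real n * k + 1)"
proof -
  have "infsum (bessel_term n k \<phi> \<theta> 0) UNIV = infsum (bessel_term n k \<phi> \<theta> 0) {(0, 0)}"
    using assms by (intro infsum_cong_neutral) (auto simp: bessel_term_def)
  then show ?thesis by (simp add: bessel_term_def)
qed

text \<open>For \<open>z \<le> 2\<close> a power \<open>(z / 2)^e\<close> with \<open>e > 0\<close>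
  is at most \<open>z / 2\<close>, so all terms but the constant one are bounded by
  \<open>z / 2\<close> times the majorant at \<open>2\<close>. Uniformity in the angles matters: the
  argument of a point tending to \<open>0\<close> need not converge.\<close>

lemma infsum_bessel_term_near_0:
  assumes k: "k > 0" and n: "n > 0" and z: "z \<ge> 0" "z \<le> 2"
  shows "\<bar>infsum (bessel_term n k \<phi> \<theta> z) UNIV - k / Gamma (real n * k + 1)\<bar> \<le>
    z / 2 * infsum (bessel_majorant n k 2) UNIV"
proof -
  let ?t = "bessel_term n k \<phi> \<theta>"
  have b: "\<bar>?t z p - ?t 0 p\<bar> \<le> z / 2 * bessel_majorant n k 2 p" for p
  proof (cases "p = (0, 0)")
    case True
    have "\<bar>?t 2 p\<bar> \<le> bessel_majorant n k 2 p"
      using k n by (intro abs_bessel_term_le) auto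
    then have "bessel_majorant n k 2 p \<ge> 0" by (rule order_trans[OF abs_ge_zero])
    moreover have "?t z p = ?t 0 p" using True by (simp add: bessel_term_def)
    ultimately show ?thesis using z by simp
  next
    case False
    obtain j l where p: "p = (j, l)" by force
    have e: "n * j + 2 * l > 0" using False n p by auto
    have "\<bar>?t z p - ?t 0 p\<bar> = (z / 2) ^ (n * j + 2 * l) * \<bar>?t 2 p\<bar>"
    proof -
      have "?t 0 p = 0"
        unfolding bessel_term_def p by (simp only: prod.case div_0 zero_power[OF e] mult_zero_left)
      moreover have "?t z p = (z / 2) ^ (n * j + 2 * l) * ?t 2 p"
        by (simp add: bessel_term_def p)
      ultimately show ?thesis using z by (simp add: abs_mult)
    qed
    also have "\<dots> \<le> z / 2 * bessel_majorant n k 2 p"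
    proof (intro mult_mono)
      show "(z / 2) ^ (n * j + 2 * l) \<le> z / 2"
        using power_decreasing[of 1 "n * j + 2 * l" "z / 2"] e z by simp
      show "\<bar>?t 2 p\<bar> \<le> bessel_majorant n k 2 p"
        using k n by (intro abs_bessel_term_le) auto
    qed (use z in auto)
    finally show ?thesis .
  qed
  have "((\<lambda>p. ?t z p + - ?t 0 p) has_sum (infsum (?t z) UNIV + - infsum (?t 0) UNIV)) UNIV"
    using k n z by (intro has_sum_add has_sum_infsum summable_bessel_term) (auto simp: has_sum_uminus intro!: has_sum_infsum summable_bessel_term)
  then have "((\<lambda>p. ?t z p - ?t 0 p) has_sum (infsum (?t z) UNIV - infsum (?t 0) UNIV)) UNIV"
    by simp
  moreover have "((\<lambda>p. z / 2 * bessel_majorant n k 2 p) has_sum z / 2 * infsum (bessel_majorant n k 2) UNIV) UNIV"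
    using k by (intro has_sum_cmult_right has_sum_infsum summable_bessel_majorant) auto
  ultimately have "norm (infsum (?t z) UNIV - infsum (?t 0) UNIV) \<le> z / 2 * infsum (bessel_majorant n k 2) UNIV"
    by (rule norm_infsum_le) (use b in auto)
  then show ?thesis using infsum_bessel_term_0[OF n] by simp
qed

section \<open>The simplex integral\<close>

definition simplex_coeff :: "nat \<Rightarrow> real \<Rightarrow> real \<Rightarrow> real \<Rightarrow> nat \<Rightarrow> real" where
  "simplex_coeff n k q z m =
     (- 4 * (z / 2) ^ n * q) ^ m / (pochhammer (2 * k) m * pochhammer k m ^ (n - 2) * fact m)"

definition simplex_series :: "nat \<Rightarrow> real \<Rightarrow> real \<Rightarrow> real fps" where
  "simplex_series n a t =
     (\<Prod>s<n. fps_rpow (1 - fps_const (2 * cos (t + 2 * pi * real s / real n)) * fps_X) (- a))"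

text \<open>Index \<open>m\<close> comes from the hypergeometric series and \<open>i\<close> from
  the exponential; the factor in the last parentheses is the Dirichlet integral with all parameters
  equal to \<open>k + m\<close>.\<close>

definition simplex_term :: "nat \<Rightarrow> real \<Rightarrow> real \<Rightarrow> real \<Rightarrow> real \<Rightarrow> nat \<times> nat \<Rightarrow> real" where
  "simplex_term n k q t z = (\<lambda>(m, i). simplex_coeff n k q z m * (z / 2) ^ i *
     (Gamma (k + real m) ^ n / Gamma (real n * (k + real m) + real i) *
      simplex_series n (k + real m) t $ i))"

lemma hypergeometric_0F_eq:
  "hypergeometric_0F (2 * k # replicate (n - 2) k) (- 4 * (z / 2) ^ n * P * q) =
    (\<Sum>m. simplex_coeff n k q z m * P ^ m)"
proof -
  have "(- 4 * (z / 2) ^ n * P * q) ^ m = (- 4 * (z / 2) ^ n * q) ^ m * P ^ m" for m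
    unfolding power_mult_distrib[symmetric] by (simp only: ac_simps)
  then show ?thesis
    by (simp only: hypergeometric_0F_def simplex_coeff_def list.map prod_list.Cons map_replicate
        prod_list_replicate) (simp add: mult_ac)
qed

lemma abs_simplex_coeff_le:
  assumes k: "k > 0"
  shows "\<bar>simplex_coeff n k q z m\<bar> \<le>
    1 / (min 1 (2 * k) * min 1 k ^ (n - 2)) * (\<bar>4 * (z / 2) ^ n * q\<bar> ^ m / fact m)"
proof -
  have p: "pochhammer (2 * k) m > 0" "pochhammer k m > 0" using k by (auto intro: pochhammer_pos)
  have "\<bar>simplex_coeff n k q z m\<bar> = \<bar>4 * (z / 2) ^ n * q\<bar> ^ m /
      (pochhammer (2 * k) m * pochhammer k m ^ (n - 2) * fact m)"
    using p by (simp add: simplex_coeff_def power_abs abs_mult)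
  also have "\<dots> \<le> \<bar>4 * (z / 2) ^ n * q\<bar> ^ m / (min 1 (2 * k) * min 1 k ^ (n - 2) * fact m)"
    using k p by (intro divide_left_mono mult_mono power_mono min_1_le_pochhammer)
      (auto intro!: mult_pos_pos mult_nonneg_nonneg)
  finally show ?thesis by simp
qed

text \<open>On the simplex the product of the coordinates is at most \<open>1\<close>, and the
  exponent is at most \<open>z\<close> in absolute value, being \<open>z / 2\<close> times a convex
  combination of numbers \<open>2 cos\<close>.\<close>

definition simplex_majorant :: "nat \<Rightarrow> real \<Rightarrow> real \<Rightarrow> real \<Rightarrow> nat \<times> nat \<Rightarrow> real" where
  "simplex_majorant n k q z p = \<bar>simplex_coeff n k q z (fst p)\<bar> * (z ^ snd p / fact (snd p))"

lemma summable_simplex_coeff: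
  assumes "k > 0"
  shows "summable (\<lambda>m. \<bar>simplex_coeff n k q z m\<bar>)"
proof (rule summable_comparison_test')
  show "summable (\<lambda>m. 1 / (min 1 (2 * k) * min 1 k ^ (n - 2)) * (\<bar>4 * (z / 2) ^ n * q\<bar> ^ m / fact m))"
    by (intro summable_mult summable_pow_fact)
  show "norm \<bar>simplex_coeff n k q z m\<bar> \<le> 1 / (min 1 (2 * k) * min 1 k ^ (n - 2)) * (\<bar>4 * (z / 2) ^ n * q\<bar> ^ m / fact m)"
    if "m \<ge> 0" for m
    using abs_simplex_coeff_le[OF assms] by simp
qed

lemma summable_simplex_majorant:
  assumes "k > 0" "z \<ge> 0"
  shows "simplex_majorant n k q z summable_on UNIV"
  unfolding simplex_majorant_def using assms
  by (intro summable_on_times[of "\<lambda>m. \<bar>simplex_coeff n k q z m\<bar>" "\<lambda>i. z ^ i / fact i"]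
      summable_simplex_coeff summable_pow_fact) auto

text \<open>Both the exponential and the hypergeometric series are expanded. The summable majorant
  times the integrable Dirichlet weight justifies integrating the double series term by
  term.\<close>

lemma simplex_integral_eq_infsum:
  fixes n :: nat and k z q t :: real
  defines "c \<equiv> \<lambda>s. 2 * cos (t + 2 * pi * real s / real n)"
  defines "F \<equiv> \<lambda>u. indicator (standard_simplex n) u * (exp (z / 2 * (\<Sum>s<n. c s * simplex_coord n u s)) *
      (\<Sum>m. simplex_coeff n k q z m * (\<Prod>s<n. simplex_coord n u s) ^ m) *
      (\<Prod>s<n. simplex_coord n u s powr (k - 1)))"
  assumes n: "n > 0" and k: "k > 0" and z: "z \<ge> 0"
  shows "simplex_term n k q t z summable_on UNIV"
    and "integral\<^sup>L (\<Pi>\<^sub>M s\<in>{1..<n}. lborel) F = infsum (simplex_term n k q t z) UNIV"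
proof -
  let ?M = "\<Pi>\<^sub>M s\<in>{1..<n}. lborel :: real measure"
  let ?U = "simplex_coord n"
  let ?p = "simplex_coeff n k q z"
  define E where "E = (\<lambda>u. \<Sum>s<n. c s * ?U u s)"
  define w where "w = (\<lambda>u. indicator (standard_simplex n) u * (\<Prod>s<n. ?U u s powr (k - 1)))"
  define T where "T = (\<lambda>(m, i) u. ?p m * (z / 2) ^ i *
     (indicator (standard_simplex n) u * (E u ^ i / fact i * (\<Prod>s<n. ?U u s powr (k + real m - 1)))))"
  have T_eq: "T (m, i) u = ?p m * (\<Prod>s<n. ?U u s) ^ m * ((z / 2 * E u) ^ i / fact i) * w u" for m i u
  proof (cases "u \<in> standard_simplex n")
    case True
    have "?U u s powr (k + real m - 1) = ?U u s ^ m * ?U u s powr (k - 1)" if "s < n" for s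
    proof (cases "?U u s = 0")
      case False
      with simplex_coord_nonneg[OF True that] have "?U u s > 0" by simp
      then show ?thesis
        by (simp add: powr_realpow[symmetric] flip: powr_add) (simp add: algebra_simps)
    qed auto
    then have "(\<Prod>s<n. ?U u s powr (k + real m - 1)) = (\<Prod>s<n. ?U u s) ^ m * (\<Prod>s<n. ?U u s powr (k - 1))"
      by (simp add: prod.distrib prod_power_distrib)
    moreover have "(z / 2 * E u) ^ i = (z / 2) ^ i * E u ^ i"
      by (rule power_mult_distrib)
    ultimately show ?thesis by (simp add: T_def w_def)
  qed (simp add: T_def w_def)
  have T_le: "\<bar>T p u\<bar> \<le> simplex_majorant n k q z p * w u" for p u
  proof (cases "u \<in> standard_simplex n")
    case True
    obtain m i where p: "p = (m, i)" by force
    have U: "0 \<le> ?U u s" "?U u s \<le> 1" if "s < n" for s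
      using simplex_coord_nonneg[OF True that] simplex_coord_le_1[OF True that] by auto
    have P: "0 \<le> (\<Prod>s<n. ?U u s)" "(\<Prod>s<n. ?U u s) \<le> 1"
      using U by (auto intro!: prod_nonneg prod_le_1)
    have "\<bar>E u\<bar> \<le> (\<Sum>s<n. \<bar>c s * ?U u s\<bar>)"
      unfolding E_def by (rule sum_abs)
    also have "\<dots> \<le> (\<Sum>s<n. 2 * ?U u s)"
    proof (intro sum_mono)
      fix s assume "s \<in> {..<n}"
      then show "\<bar>c s * ?U u s\<bar> \<le> 2 * ?U u s"
        using U[of s] by (auto simp: c_def abs_mult intro!: mult_left_le_one_le)
    qed
    also have "\<dots> = 2"
      using sum_simplex_coord_eq_1[OF n, of u] by (simp flip: sum_distrib_left)
    finally have "\<bar>z / 2 * E u\<bar> \<le> z"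
      using z mult_left_mono[of "\<bar>E u\<bar>" 2 "z / 2"] by (simp add: abs_mult)
    then have e: "\<bar>(z / 2 * E u) ^ i / fact i\<bar> \<le> z ^ i / fact i"
      by (simp add: power_abs divide_right_mono power_mono)
    have w0: "w u \<ge> 0" by (auto simp: w_def intro!: mult_nonneg_nonneg prod_nonneg)
    have "\<bar>T p u\<bar> = \<bar>?p m\<bar> * (\<Prod>s<n. ?U u s) ^ m * \<bar>(z / 2 * E u) ^ i / fact i\<bar> * w u"
      unfolding p T_eq abs_mult using P w0 by simp
    also have "\<dots> \<le> \<bar>?p m\<bar> * 1 * (z ^ i / fact i) * w u"
      using P w0 z e by (intro mult_mono mult_nonneg_nonneg power_le_one) auto
    finally show ?thesis by (simp add: simplex_majorant_def p)
  next
    case False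
    then show ?thesis by (cases p) (simp add: T_eq w_def)
  qed
  have M: "simplex_majorant n k q z summable_on UNIV"
    using k z by (rule summable_simplex_majorant)
  have Tu: "(\<lambda>p. T p u) summable_on UNIV" for u
    by (rule summable_on_norm_le[OF summable_on_cmult_left[OF M] T_le])
  have B: "has_bochner_integral ?M (T p) (simplex_term n k q t z p)" for p
  proof -
    obtain m i where p: "p = (m, i)" by force
    have "k + real m > 0" using k by simp
    from has_bochner_integral_mult_right[OF has_bochner_integral_Dirichlet_power[OF n this, of c i],
        of "?p m * (z / 2) ^ i"]
    show ?thesis
      by (simp add: p T_def E_def simplex_term_def simplex_series_def c_def)
  qed
  have Bw: "has_bochner_integral ?M w ((\<Prod>s<n. Gamma k) / Gamma (\<Sum>s<n. k))"
    unfolding w_def by (rule has_bochner_integral_Dirichlet) (use n k in auto)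
  define W where "W = integral\<^sup>L ?M w"
  \<comment> \<open>Pairs are enumerated because integral and sum are exchanged along a
    sequence.\<close>
  have bij: "bij_betw prod_decode UNIV UNIV"
    by (rule bij_prod_decode)
  have nT: "(\<integral>u. norm (T p u) \<partial>?M) \<le> simplex_majorant n k q z p * W" for p
  proof -
    have "(\<integral>u. norm (T p u) \<partial>?M) \<le> (\<integral>u. simplex_majorant n k q z p * w u \<partial>?M)"
      using B Bw T_le by (intro integral_mono integrable_norm integrable_mult_right)
        (auto simp: has_bochner_integral_iff)
    then show ?thesis by (simp add: W_def)
  qed
  have sM: "summable (\<lambda>N. simplex_majorant n k q z (prod_decode N))"
    using summable_on_reindex_bij_betw[OF bij, of "simplex_majorant n k q z"] M
    by (auto intro: summable_on_imp_summable)
  have sT: "(\<lambda>N. T (prod_decode N) u) sums infsum (\<lambda>p. T p u) UNIV" for u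
  proof -
    have "((\<lambda>N. T (prod_decode N) u) has_sum infsum (\<lambda>p. T p u) UNIV) UNIV"
      using has_sum_reindex_bij_betw[OF bij, of "\<lambda>p. T p u"] Tu[of u] by simp
    then show ?thesis by (rule has_sum_imp_sums)
  qed
  have snT: "summable (\<lambda>N. norm (T (prod_decode N) u))" for u
    by (rule summable_comparison_test'[OF summable_mult2[OF sM, of "w u"], of 0]) (simp add: T_le)
  have sI: "summable (\<lambda>N. \<integral>u. norm (T (prod_decode N) u) \<partial>?M)"
    by (rule summable_comparison_test'[OF summable_mult2[OF sM, of W], of 0])
      (use nT in \<open>auto simp: integral_nonneg_AE\<close>)
  have iT: "integrable ?M (T (prod_decode N))" for N
    using B by (simp add: has_bochner_integral_iff)
  have F_eq: "F u = infsum (\<lambda>p. T p u) UNIV" for u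
  proof -
    have "(\<lambda>m. \<Sum>i. T (m, i) u) sums infsum (\<lambda>p. T p u) UNIV"
      using summable_on_pairs_sums(2)[OF Tu[of u]] by simp
    moreover have "(\<Sum>i. T (m, i) u) = exp (z / 2 * E u) * w u * (?p m * (\<Prod>s<n. ?U u s) ^ m)" for m
    proof -
      have "(\<lambda>i. (z / 2 * E u) ^ i / fact i) sums exp (z / 2 * E u)"
        using exp_converges[of "z / 2 * E u"] by (simp add: field_simps)
      from sums_mult[OF this, of "w u * (?p m * (\<Prod>s<n. ?U u s) ^ m)"]
      show ?thesis unfolding T_eq by (simp add: sums_iff mult_ac)
    qed
    ultimately have s: "(\<lambda>m. exp (z / 2 * E u) * w u * (?p m * (\<Prod>s<n. ?U u s) ^ m)) sums infsum (\<lambda>p. T p u) UNIV"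
      by simp
    show ?thesis
    \<comment> \<open>Dividing by \<open>exp (z / 2 * E u) * w u\<close> recovers the hypergeometric
      sum. Where the weight is \<open>0\<close>, outside the simplex or at a zero coordinate, both
      sides are \<open>0\<close>.\<close>
    proof (cases "w u = 0")
      case True
      with s have "infsum (\<lambda>p. T p u) UNIV = 0" by (simp add: sums_iff)
      moreover have "F u = 0" using True by (auto simp: F_def w_def)
      ultimately show ?thesis by simp
    next
      case False
      then have "(\<lambda>m. ?p m * (\<Prod>s<n. ?U u s) ^ m) sums (infsum (\<lambda>p. T p u) UNIV / (exp (z / 2 * E u) * w u))"
        using sums_divide[OF s, of "exp (z / 2 * E u) * w u"] by simp
      then have "(\<Sum>m. ?p m * (\<Prod>s<n. ?U u s) ^ m) = infsum (\<lambda>p. T p u) UNIV / (exp (z / 2 * E u) * w u)"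
        by (simp add: sums_iff)
      moreover have "F u = exp (z / 2 * E u) * w u * (\<Sum>m. ?p m * (\<Prod>s<n. ?U u s) ^ m)"
        by (simp add: F_def w_def E_def)
      ultimately show ?thesis using False by simp
    qed
  qed
  show sS: "simplex_term n k q t z summable_on UNIV"
  proof (rule summable_on_norm_le[OF summable_on_cmult_left[OF M, of W]])
    fix p
    have "norm (integral\<^sup>L ?M (T p)) \<le> (\<integral>u. norm (T p u) \<partial>?M)" by (rule integral_norm_bound)
    with nT[of p] B[of p] show "\<bar>simplex_term n k q t z p\<bar> \<le> simplex_majorant n k q z p * W"
      by (simp add: has_bochner_integral_iff)
  qed
  have "integral\<^sup>L ?M F = (\<integral>u. (\<Sum>N. T (prod_decode N) u) \<partial>?M)"
  proof -
    have "F = (\<lambda>u. \<Sum>N. T (prod_decode N) u)"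
      using sT by (intro ext) (simp add: F_eq sums_iff)
    then show ?thesis by simp
  qed
  also have "\<dots> = (\<Sum>N. integral\<^sup>L ?M (T (prod_decode N)))"
    using iT snT sI by (intro integral_suminf) auto
  also have "\<dots> = (\<Sum>N. simplex_term n k q t z (prod_decode N))"
    using B by (simp add: has_bochner_integral_iff)
  also have "\<dots> = infsum (simplex_term n k q t z) UNIV"
  proof -
    have "((\<lambda>N. simplex_term n k q t z (prod_decode N)) has_sum infsum (simplex_term n k q t z) UNIV) UNIV"
      using has_sum_reindex_bij_betw[OF bij, of "simplex_term n k q t z"] sS by simp
    from has_sum_imp_sums[OF this] show ?thesis by (simp add: sums_iff)
  qed
  finally show "integral\<^sup>L ?M F = infsum (simplex_term n k q t z) UNIV" .
qed

section \<open>Comparison of the two double series by degree\<close>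

lemma finite_degree_fibre: "a > 0 \<Longrightarrow> b > 0 \<Longrightarrow> finite {p :: nat \<times> nat. a * fst p + b * snd p = N}"
  by (rule finite_subset[of _ "{..N} \<times> {..N}"]) (auto intro: order_trans[OF _ le_add1] order_trans[OF _ le_add2])

lemma nth_sum_shifted:
  fixes a :: "nat \<Rightarrow> real" and Q :: "nat \<Rightarrow> real fps"
  assumes n: "n > 0"
  shows "(\<Sum>m\<le>N. fps_const (a m) * (fps_X ^ (n * m) * Q m)) $ N =
    (\<Sum>p | n * fst p + snd p = N. a (fst p) * Q (fst p) $ snd p)"
proof -
  have "(\<Sum>m\<le>N. fps_const (a m) * (fps_X ^ (n * m) * Q m)) $ N =
      (\<Sum>m | n * m \<le> N. a m * Q m $ (N - n * m))"
    unfolding fps_sum_nth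
  proof (rule sum.mono_neutral_cong_right)
    show "{m. n * m \<le> N} \<subseteq> {..N}"
      using n by (auto intro: order_trans[rotated])
  qed (auto simp: fps_X_power_mult_nth)
  also have "\<dots> = (\<Sum>p | n * fst p + snd p = N. a (fst p) * Q (fst p) $ snd p)"
    by (rule sum.reindex_bij_witness[where i = fst and j = "\<lambda>m. (m, N - n * m)"]) auto
  finally show ?thesis .
qed

lemma nth_sum_shifted_even:
  fixes a :: "nat \<Rightarrow> real" and A :: "nat \<Rightarrow> real fps"
  assumes n: "n > 0"
  shows "(\<Sum>j\<le>N. fps_const (a j) * (fps_X ^ (n * j) * (A j oo fps_X\<^sup>2))) $ N =
    (\<Sum>p | n * fst p + 2 * snd p = N. a (fst p) * A (fst p) $ snd p)"
proof -
  have fin: "finite {p :: nat \<times> nat. n * fst p + snd p = N}"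
    using finite_degree_fibre[OF n, of 1 N] by simp
  have "(\<Sum>j\<le>N. fps_const (a j) * (fps_X ^ (n * j) * (A j oo fps_X\<^sup>2))) $ N =
      (\<Sum>p | n * fst p + snd p = N. a (fst p) * (A (fst p) oo fps_X\<^sup>2) $ snd p)"
    by (rule nth_sum_shifted[OF n])
  also have "\<dots> = (\<Sum>p | n * fst p + snd p = N \<and> even (snd p). a (fst p) * A (fst p) $ (snd p div 2))"
    by (rule sum.mono_neutral_cong_right[OF fin]) (auto simp: fps_nth_compose_X_power)
  also have "\<dots> = (\<Sum>p | n * fst p + 2 * snd p = N. a (fst p) * A (fst p) $ snd p)"
    by (rule sum.reindex_bij_witness[where i = "\<lambda>p. (fst p, 2 * snd p)" and j = "\<lambda>p. (fst p, snd p div 2)"]) auto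
  finally show ?thesis .
qed

text \<open>Degree \<open>N\<close> collects the pairs with \<open>n * m + i = N\<close> on one side
  and \<open>n * j + 2 * l = N\<close> on the other. Once the common factor \<open>C N\<close> is
  split off, the two fibre sums are the coefficients of index \<open>N\<close> compared in
  \<open>gegenbauer_simplex_coefficients\<close>.\<close>

lemma infsum_simplex_term_eq:
  assumes n: "n \<ge> 2" and k: "k > 0" and z: "z \<ge> 0" and \<phi>: "\<phi> \<in> {0..pi / real n}"
  shows "infsum (simplex_term n k (sin (real n * \<phi>) * sin (real n * \<theta>)) (\<theta> - \<phi>) z) UNIV =
    real n * Gamma k ^ n * infsum (bessel_term n k \<phi> \<theta> z) UNIV"
proof -
  let ?q = "sin (real n * \<phi>) * sin (real n * \<theta>)"
  let ?s = "simplex_term n k ?q (\<theta> - \<phi>) z" and ?b = "bessel_term n k \<phi> \<theta> z"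
  have n0: "n > 0" using n by simp
  define C where "C = (\<lambda>N. (z / 2) ^ N * Gamma k ^ n / Gamma (real n * k + real N))"
  define a where "a = (\<lambda>m. gegenbauer_product_coeff k m * ?q ^ m)"
  define Q where "Q = (\<lambda>m. simplex_series n (k + real m) (\<theta> - \<phi>))"
  define G where "G = (\<lambda>j. gegenbauer_product k j (real n * \<theta>) (real n * \<phi>))"
  define A where "A = (\<lambda>j. Abs_fps (catalan_power_coeff (real n * (k + real j))))"
  have s: "?s p = C N * (a (fst p) * Q (fst p) $ snd p)" if N: "n * fst p + snd p = N" for p N
  proof -
    obtain m i where p: "p = (m, i)" by force
    have N: "N = n * m + i" using N p by simp
    have pos: "pochhammer k m > 0" "pochhammer (2 * k) m > 0" using k by (auto intro: pochhammer_pos)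
    have "pochhammer k m = Gamma (k + real m) / Gamma k"
      using k by (intro pochhammer_Gamma) (auto elim!: nonpos_Ints_cases)
    moreover have "Gamma k \<noteq> 0"
      using Gamma_real_pos[OF k] by linarith
    ultimately have "Gamma (k + real m) = pochhammer k m * Gamma k" by simp
    \<comment> \<open>After division by the \<open>n - 2\<close> symbols with parameter
      \<open>k\<close> a square remains: the one in \<open>gegenbauer_product_coeff\<close>.\<close>
    moreover have "pochhammer k m ^ n = pochhammer k m ^ (n - 2) * (pochhammer k m)\<^sup>2"
      by (metis le_add_diff_inverse2 n power_add)
    moreover have "(- 4 * (z / 2) ^ n * ?q) ^ m = (- 4) ^ m * (z / 2) ^ (n * m) * ?q ^ m"
      by (simp only: power_mult_distrib power_mult)
    moreover have "real n * (k + real m) + real i = real n * k + real N"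
      by (simp add: N algebra_simps)
    ultimately show ?thesis
      using pos
      by (simp add: p simplex_term_def simplex_coeff_def C_def a_def Q_def gegenbauer_product_coeff_def
          power_mult_distrib N power_add del: power_mult_distrib mult_minus_left)
        (simp add: power_mult_distrib mult_ac add_ac)
  qed
  have b: "real n * Gamma k ^ n * ?b p = C N * (G (fst p) * A (fst p) $ snd p)"
    if N: "n * fst p + 2 * snd p = N" for p N
  proof -
    obtain j l where p: "p = (j, l)" by force
    have N: "N = n * j + 2 * l" using N p by simp
    have "real n * \<phi> \<in> {0..pi}" using \<phi> n0 by (auto simp: field_simps)
    then have G: "gegenbauer k j (cos (real n * \<phi>)) * gegenbauer k j (cos (real n * \<theta>)) / gegenbauer k j 1 = G j"
      unfolding G_def by (rule gegenbauer_product_formula[OF k])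
    have "real n * k + real N > 0" using n0 k by (intro add_pos_nonneg) auto
    then have "Gamma (real n * k + real N) \<noteq> 0"
      using Gamma_real_pos[of "real n * k + real N"] by linarith
    moreover have "real n * (k + real j) + 2 * real l = real n * k + real N"
      "real n * (k + real j) + real l + 1 = real n * real j + real n * k + real l + 1"
      by (simp_all add: N algebra_simps)
    then have "A j $ l = real n * (k + real j) * Gamma (real n * k + real N) /
        (fact l * Gamma (real n * real j + real n * k + real l + 1))"
      unfolding A_def catalan_power_coeff_def by (simp only: fps_nth_Abs_fps)
    ultimately show ?thesis
      unfolding p bessel_term_def prod.case G fst_conv snd_conv C_def N[symmetric]
      by (simp add: mult_ac add.commute)
  qed
  have fs: "finite {p :: nat \<times> nat. n * fst p + snd p = N}" for N
    using finite_degree_fibre[OF n0, of 1 N] by simp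
  have fb: "finite {p :: nat \<times> nat. n * fst p + 2 * snd p = N}" for N
    using finite_degree_fibre[OF n0, of 2 N] by simp
  have "infsum ?s UNIV = (\<Sum>\<^sub>\<infinity>N. \<Sum>p | n * fst p + snd p = N. ?s p)"
    using n0 k z by (intro infsum_group[of ?s "\<lambda>p. n * fst p + snd p"] simplex_integral_eq_infsum(1) fs)
  also have "\<dots> = (\<Sum>\<^sub>\<infinity>N. \<Sum>p | n * fst p + 2 * snd p = N. real n * Gamma k ^ n * ?b p)"
  proof (intro infsum_cong)
    fix N
    have "(\<Sum>p | n * fst p + snd p = N. ?s p) = C N * (\<Sum>p | n * fst p + snd p = N. a (fst p) * Q (fst p) $ snd p)"
      unfolding sum_distrib_left by (intro sum.cong) (auto simp: s)
    also have "\<dots> = C N * (\<Sum>m\<le>N. fps_const (a m) * (fps_X ^ (n * m) * Q m)) $ N"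
      by (simp only: nth_sum_shifted[OF n0])
    also have "\<dots> = C N * (\<Sum>j\<le>N. fps_const (G j) * (fps_X ^ (n * j) * (A j oo fps_X\<^sup>2))) $ N"
      using gegenbauer_simplex_coefficients[OF n0 k, of \<phi> \<theta> N]
      by (simp only: a_def Q_def G_def A_def simplex_series_def)
    also have "\<dots> = C N * (\<Sum>p | n * fst p + 2 * snd p = N. G (fst p) * A (fst p) $ snd p)"
      by (simp only: nth_sum_shifted_even[OF n0])
    also have "\<dots> = (\<Sum>p | n * fst p + 2 * snd p = N. real n * Gamma k ^ n * ?b p)"
      unfolding sum_distrib_left by (intro sum.cong) (auto simp: b)
    finally show "(\<Sum>p | n * fst p + snd p = N. ?s p) =
      (\<Sum>p | n * fst p + 2 * snd p = N. real n * Gamma k ^ n * ?b p)" .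
  qed
  also have "\<dots> = infsum (\<lambda>p. real n * Gamma k ^ n * ?b p) UNIV"
    using n0 k z by (intro infsum_group[symmetric] summable_on_cmult_right summable_bessel_term fb)
  also have "\<dots> = real n * Gamma k ^ n * infsum ?b UNIV"
    using n0 k z by (intro infsum_cmult_right summable_bessel_term)
  finally show ?thesis .
qed

section \<open>Values where one of the points is the origin\<close>

lemma rcis_in_closure_weyl_chamber:
  assumes n: "n > 0" and \<rho>: "\<rho> \<ge> 0" and \<phi>: "\<phi> \<in> {0..pi / real n}"
  shows "rcis \<rho> \<phi> \<in> closure (weyl_chamber n)"
proof -
  define t where "t = (\<lambda>m. inverse (real (Suc m)))"
  have t: "t \<longlonglongrightarrow> 0" unfolding t_def by (rule LIMSEQ_inverse_real_of_nat)
  \<comment> \<open>The radius is enlarged by \<open>t m\<close> and the angle is pulled towards the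
    bisector \<open>pi / (2 n)\<close>, which puts the approximating points strictly inside the
    chamber even for limits on a wall or at the origin.\<close>
  define f where "f = (\<lambda>m. rcis (\<rho> + t m) ((1 - t m) * \<phi> + t m * (pi / real n / 2)))"
  have "f m \<in> weyl_chamber n" for m
  proof -
    have tm: "0 < t m" "t m \<le> 1" by (auto simp: t_def inverse_le_1_iff)
    have h: "pi / real n > 0" using n by simp
    have "0 \<le> (1 - t m) * \<phi>" using tm \<phi> by simp
    moreover have "t m * (pi / real n / 2) > 0" by (rule mult_pos_pos[OF tm(1) half_gt_zero[OF h]])
    moreover have "(1 - t m) * \<phi> \<le> (1 - t m) * (pi / real n)"
      using tm \<phi> by (intro mult_left_mono) auto
    moreover have "(1 - t m) * (pi / real n) + t m * (pi / real n / 2) = pi / real n - t m * (pi / real n / 2)"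
      using n by (simp add: field_simps)
    ultimately have "0 < (1 - t m) * \<phi> + t m * (pi / real n / 2)"
      "(1 - t m) * \<phi> + t m * (pi / real n / 2) < pi / real n"
      by linarith+
    moreover have "\<rho> + t m > 0" using \<rho> tm by simp
    ultimately show ?thesis unfolding f_def weyl_chamber_def by blast
  qed
  moreover have "f \<longlonglongrightarrow> rcis (\<rho> + 0) ((1 - 0) * \<phi> + 0 * (pi / real n / 2))"
    unfolding f_def rcis_def cis.ctr by (intro tendsto_intros t)
  ultimately show ?thesis
    unfolding closure_sequential by auto
qed

text \<open>The estimate near \<open>0\<close> involves only the product of the moduli, which tends
  to \<open>0\<close> when either limit point is \<open>0\<close>; the arguments may behave
  arbitrarily.\<close>

lemma dihedral_bessel_series_tendsto:
  fixes n :: nat and k c :: real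
  defines "S \<equiv> closure (weyl_chamber n) - {0}"
    and "D \<equiv> \<lambda>(x, y). dihedral_bessel_series c n k (cmod x) (Arg x) (cmod y) (Arg y)"
  assumes n: "n > 0" and k: "k > 0" and xy: "x = 0 \<or> y = 0"
  shows "(D \<longlongrightarrow> c / Beta (k + 1/2) (1/2) * (k / Gamma (real n * k + 1))) (at (x, y) within S \<times> S)"
proof (rule LIM_zero_cancel, rule Lim_null_comparison)
  let ?F = "at (x, y) within S \<times> S"
  let ?B = "c / Beta (k + 1/2) (1/2)"
  let ?K = "infsum (bessel_majorant n k 2) UNIV"
  have "((\<lambda>p. cmod (fst p) * cmod (snd p)) \<longlongrightarrow> cmod (fst (x, y)) * cmod (snd (x, y))) ?F"
    by (intro tendsto_intros)
  then have z: "((\<lambda>p. cmod (fst p) * cmod (snd p)) \<longlongrightarrow> 0) ?F"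
    using xy by auto
  then have "\<forall>\<^sub>F p in ?F. cmod (fst p) * cmod (snd p) < 2"
    by (rule order_tendstoD) simp
  moreover have "\<forall>\<^sub>F p in ?F. p \<in> S \<times> S"
    by (simp add: eventually_at_filter)
  ultimately show "\<forall>\<^sub>F p in ?F. norm (D p - ?B * (k / Gamma (real n * k + 1))) \<le>
      \<bar>?B\<bar> * (cmod (fst p) * cmod (snd p) / 2 * ?K)"
  proof eventually_elim
    case (elim p)
    obtain x' y' where p: "p = (x', y')" by force
    have nz: "cmod x' > 0" "cmod y' > 0" using elim(2) by (auto simp: p S_def)
    have "D p - ?B * (k / Gamma (real n * k + 1)) =
        ?B * (infsum (bessel_term n k (Arg x') (Arg y') (cmod x' * cmod y')) UNIV - k / Gamma (real n * k + 1))"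
      unfolding p D_def prod.case dihedral_bessel_series_eq[OF k n nz] by (simp add: right_diff_distrib)
    also have "norm \<dots> \<le> \<bar>?B\<bar> * (cmod x' * cmod y' / 2 * ?K)"
      unfolding real_norm_def abs_mult
      using elim(1) by (intro mult_left_mono infsum_bessel_term_near_0 k n) (auto simp: p)
    finally show ?case by (simp add: p)
  qed
  show "((\<lambda>p. \<bar>?B\<bar> * (cmod (fst p) * cmod (snd p) / 2 * ?K)) \<longlongrightarrow> 0) ?F"
    using tendsto_mult_right[OF tendsto_mult_left[OF tendsto_divide[OF z tendsto_const[of 2]]], of "\<bar>?B\<bar>" ?K]
    by (simp add: mult_ac)
qed

lemma dihedral_bessel_with_eq:
  assumes n: "n > 0" and k: "k > 0" and "\<rho> \<ge> 0" "r \<ge> 0"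
    and \<phi>: "\<phi> \<in> {0..pi / real n}" and \<theta>: "\<theta> \<in> {0..pi / real n}"
  shows "dihedral_bessel_with c n k (rcis \<rho> \<phi>) (rcis r \<theta>) =
    c / Beta (k + 1/2) (1/2) * infsum (bessel_term n k \<phi> \<theta> (\<rho> * r)) UNIV"
proof (cases "\<rho> > 0 \<and> r > 0")
  case True
  have Arg: "Arg (rcis a t) = t" if "a > 0" "t \<in> {0..pi / real n}" for a t
  proof (rule cis_Arg_unique)
    show "sgn (rcis a t) = cis t" using that by (simp add: sgn_eq rcis_def norm_mult)
    have "pi / real n \<le> pi" using n by (simp add: divide_le_eq)
    with that show "- pi < t" "t \<le> pi" by (auto intro: less_le_trans[of _ 0])
  qed
  have "rcis \<rho> \<phi> \<noteq> 0" "rcis r \<theta> \<noteq> 0"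
    "Arg (rcis \<rho> \<phi>) = \<phi>" "Arg (rcis r \<theta>) = \<theta>"
    using True \<phi> \<theta> Arg by auto
  then show ?thesis
    using True by (simp add: dihedral_bessel_with_def dihedral_bessel_series_eq[OF k n])
next
  case False
  let ?x = "rcis \<rho> \<phi>" and ?y = "rcis r \<theta>" and ?C = "weyl_chamber n"
  let ?S = "closure ?C - {0}"
  have "\<rho> = 0 \<or> r = 0" using False assms by auto
  then have xy: "?x = 0 \<or> ?y = 0" and z: "\<rho> * r = 0" by auto
  have C0: "0 \<notin> ?C" by (auto simp: weyl_chamber_def)
  \<comment> \<open>The value of \<open>Lim\<close> is determined only at a limit point. The pair
    lies in the closure of the product of chambers but not in the product, one component being
    \<open>0\<close>, so it is a limit point.\<close>
  have "(?x, ?y) \<in> closure (?C \<times> ?C)"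
    unfolding closure_Times using assms by (auto intro: rcis_in_closure_weyl_chamber)
  moreover have "(?x, ?y) \<notin> ?C \<times> ?C"
    using xy C0 by auto
  ultimately have "(?x, ?y) islimpt (?C \<times> ?C)"
    unfolding closure_def by blast
  moreover have "?C \<times> ?C \<subseteq> ?S \<times> ?S"
    using C0 closure_subset[of ?C] by auto
  ultimately have "(?x, ?y) islimpt (?S \<times> ?S)"
    by (rule islimpt_subset)
  then have "at (?x, ?y) within ?S \<times> ?S \<noteq> bot"
    using trivial_limit_within by blast
  from tendsto_Lim[OF this dihedral_bessel_series_tendsto[OF n k xy]] xy
  show ?thesis
    unfolding z infsum_bessel_term_0[OF n]
    by (auto simp: dihedral_bessel_with_def Let_def)
qed

theorem corollary2:
  fixes n :: nat and k \<rho> r \<phi> \<theta> :: real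
    and b :: "nat \<Rightarrow> real"
  assumes "n \<ge> 3" and "k > 0"
    and "\<rho> \<ge> 0" and "r \<ge> 0"
    and "\<phi> \<in> {0..pi / real n}" and "\<theta> \<in> {0..pi / real n}"
  defines "b \<equiv> \<lambda>s. cos (\<theta> - \<phi> + 2 * pi * real s / real n)"
  shows "dihedral_bessel n k (rcis \<rho> \<phi>) (rcis r \<theta>) =
    dihedral_bessel_const n k / (real n * Beta (k + 1/2) (1/2) * Gamma k ^ n) *
    (LINT u : standard_simplex n | \<Pi>\<^sub>M s\<in>{1..<n}. lborel.
       exp (\<rho> * r * (simplex_u0 n u * cos (\<theta> - \<phi>) + (\<Sum>s=1..<n. u s * b s))) *
       hypergeometric_0F (2 * k # replicate (n - 2) k)
         (- 4 * (\<rho> * r / 2) ^ n * (simplex_u0 n u * (\<Prod>s=1..<n. u s))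
            * sin (real n * \<theta>) * sin (real n * \<phi>)) *
       simplex_u0 n u powr (k - 1) * (\<Prod>s=1..<n. u s powr (k - 1)))"
proof -
  define z where "z = \<rho> * r"
  let ?q = "sin (real n * \<phi>) * sin (real n * \<theta>)"
  let ?c = "\<lambda>s. 2 * cos (\<theta> - \<phi> + 2 * pi * real s / real n)"
  let ?F = "\<lambda>u. exp (z * (simplex_u0 n u * cos (\<theta> - \<phi>) + (\<Sum>s=1..<n. u s * b s))) *
       hypergeometric_0F (2 * k # replicate (n - 2) k)
         (- 4 * (z / 2) ^ n * (simplex_u0 n u * (\<Prod>s=1..<n. u s))
            * sin (real n * \<theta>) * sin (real n * \<phi>)) *
       simplex_u0 n u powr (k - 1) * (\<Prod>s=1..<n. u s powr (k - 1))"
  have n: "n > 0" "n \<ge> 2" and z: "z \<ge> 0" using assms by (auto simp: z_def)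
  have "?F u = exp (z / 2 * (\<Sum>s<n. ?c s * simplex_coord n u s)) *
      (\<Sum>m. simplex_coeff n k ?q z m * (\<Prod>s<n. simplex_coord n u s) ^ m) *
      (\<Prod>s<n. simplex_coord n u s powr (k - 1))" for u
  proof -
    \<comment> \<open>The coordinate \<open>s = 0\<close> supplies
      \<open>u_0 * cos (\<theta> - \<phi>)\<close>, and \<open>z / 2\<close> absorbs the factor
      \<open>2\<close> of \<open>?c s\<close>.\<close>
    have "(\<Sum>s=1..<n. ?c s * u s) = 2 * (\<Sum>s=1..<n. u s * b s)"
      unfolding sum_distrib_left by (intro sum.cong) (auto simp: b_def)
    then have A1: "z / 2 * (\<Sum>s<n. ?c s * simplex_coord n u s) =
        z * (simplex_u0 n u * cos (\<theta> - \<phi>) + (\<Sum>s=1..<n. u s * b s))"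
      unfolding sum_simplex_coord[OF n(1), of "\<lambda>s x. ?c s * x"] by (simp add: algebra_simps)
    have A2: "- 4 * (z / 2) ^ n * (simplex_u0 n u * (\<Prod>s=1..<n. u s)) * sin (real n * \<theta>) * sin (real n * \<phi>)
        = - 4 * (z / 2) ^ n * (\<Prod>s<n. simplex_coord n u s) * ?q"
      unfolding prod_simplex_coord[OF n(1), of "\<lambda>s x. x"] by (simp only: ac_simps)
    have A3: "simplex_u0 n u powr (k - 1) * (\<Prod>s=1..<n. u s powr (k - 1)) =
        (\<Prod>s<n. simplex_coord n u s powr (k - 1))"
      unfolding prod_simplex_coord[OF n(1), of "\<lambda>s x. x powr (k - 1)"] ..
    show ?thesis
      unfolding A1 A2 hypergeometric_0F_eq A3[symmetric] by (simp only: mult.assoc)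
  qed
  then have "(LINT u : standard_simplex n | \<Pi>\<^sub>M s\<in>{1..<n}. lborel. ?F u) =
      infsum (simplex_term n k ?q (\<theta> - \<phi>) z) UNIV"
    using simplex_integral_eq_infsum(2)[OF n(1) assms(2) z, where t = "\<theta> - \<phi>" and q = ?q]
    by (simp only: set_lebesgue_integral_def real_scaleR_def)
  also have "\<dots> = real n * Gamma k ^ n * infsum (bessel_term n k \<phi> \<theta> z) UNIV"
    by (rule infsum_simplex_term_eq[OF n(2) assms(2) z assms(5)])
  finally have I: "(LINT u : standard_simplex n | \<Pi>\<^sub>M s\<in>{1..<n}. lborel. ?F u) =
    real n * Gamma k ^ n * infsum (bessel_term n k \<phi> \<theta> z) UNIV" .
  have "Gamma k \<noteq> 0" using Gamma_real_pos[OF assms(2)] by linarith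
  then show ?thesis
    unfolding dihedral_bessel_def dihedral_bessel_with_eq[OF n(1) assms(2-6)] I[unfolded z_def]
    using n(1) by (simp add: z_def)
qed

end
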